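(* Let $P$ be a contractible patch in $\mathbb{R}^3$, let $p\ge 1$, $n_{\rm p}=p(p+1)/2$, and let $\boldsymbol r^{(i,j)}$ ($0\le i+j\le p-1$) be a set of $n_{\rm p}$ collocation points on $P$. Suppose that the density $\sigma$ in the Laplace single layer potential is approximated by $$\sigma(\boldsymbol r)\approx\sum_{l=1}^p\sum_{m=1}^l \nabla H^{(l,m)}(\boldsymbol r)\cdot\boldsymbol\nu(\boldsymbol r)\, d^{(l,m)},$$ where $d^{(l,m)}$ are scalar coefficients determined by the $n_{\rm p}\times n_{\rm p}$ linear system $$\sum_{l=1}^p\sum_{m=1}^l\nabla H^{(l,m)}(\boldsymbol r^{(i,j)})\cdot\boldsymbol\nu(\boldsymbol r^{(i,j)})\,d^{(l,m)}=\sigma(\boldsymbol r^{(i,j)}),\qquad 0\le i+j\le p-1.$$ Let $\rho$ be the intermediate double layer density defined by $$\rho(\boldsymbol r)=\sum_{l=1}^p\sum_{m=1}^l H^{(l,m)}(\boldsymbol r)\,d^{(l,m)},$$ and approximate $\rho$ using the quaternion basis $(0,\nabla H^{(l,m)})$: $$(\rho(\boldsymbol r),\boldsymbol 0)\approx\sum_{l=1}^p\sum_{m=1}^l (0,\nabla H^{(l,m)}(\boldsymbol r))\,g^{(l,m)},\qquad \boldsymbol r\in P,$$ with quaternion coefficients $g^{(l,m)}$. Then the Laplace single layer potential on $P$ can be reduced to the evaluation of 1-forms as follows: $$\mathcal S[\sigma](\boldsymbol r')=\int_P G(\boldsymbol r',\boldsymbol r)\sigma(\boldsymbol r)\,da(\boldsymbol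 r)\approx\sum_{l=1}^p\sum_{m=1}^l\int_{\partial P}\left(\psi^{(l,m)}(\boldsymbol r',\boldsymbol r)\,d^{(l,m)}-\left[\beta^{(l,m)}(\boldsymbol r',\boldsymbol r)\,g^{(l,m)}\right]_0\right),$$ where $\psi^{(l,m)}$ (real-valued) and $\beta^{(l,m)}$ (quaternion-valued) are 1-forms in $\boldsymbol r$ satisfying $$d\psi^{(l,m)}=\chi^{(l,m)},\qquad d\beta^{(l,m)}=\alpha^{(l,m)},$$ with the 2-forms $\chi^{(l,m)},\alpha^{(l,m)}$ defined in the context.
   Context: Patch: $P$ is a smooth oriented surface patch (e.g. a curved triangle) with boundary $\partial P$; $\boldsymbol\nu(\boldsymbol r)$ is its unit normal and $da$ its area element. $\boldsymbol r'\in\mathbb{R}^3$ is the target point and $\boldsymbol r$ the source point. All gradients $\nabla$ and exterior derivatives $d$ are with respect to $\boldsymbol r$. Kernel: $G(\boldsymbol r',\boldsymbol r)=\dfrac{1}{4\pi|\boldsymbol r'-\boldsymbol r|}$, the Laplace Green's function; $\mathcal S[\sigma]$ is the Laplace single layer potential of $\sigma$ on $P$. Approximation: the sign $\approx$ in the conclusion refers to replacing $\sigma$ and $\rho$ by their approximations displayed in the claim; the quaternion approximation of $\rho$ is the one obtained by imposing equality at the collocation points. Quaternions: a quaternion $f=f_0+f_1\boldsymbol i+f_2\boldsymbol j+f_3\boldsymbol k$ is written $f=(f_0,\boldsymbol f)$ with $f_0$ the scalar part and $\boldsymbol f\in\mathbb{R}^3$ the vector part; the product is $fg=(f_0g_0-\boldsymbol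 f\cdot\boldsymbol g,\ f_0\boldsymbol g+g_0\boldsymbol f+\boldsymbol f\times\boldsymbol g)$; $[\cdot]_0$ denotes the scalar part. Integration and exterior differentiation of quaternion-valued forms are componentwise. Harmonic polynomials: for $1\le m\le l$, with $r^2=x^2+y^2+z^2$, $$H^{(l,m)}(x,y,z)=\left[\frac{2(l-m)!}{(l+m)!}\right]^{1/2}\Pi_l^m(x,r)B_m(y,z),\quad B_m(y,z)=\frac{1}{2i}[(y+iz)^m-(y-iz)^m],$$ $$\Pi_l^m(x,r)=\sum_{k=0}^{\lfloor(l-m)/2\rfloor}\gamma_{lk}^{(m)}r^{2k}x^{l-2k-m},\quad \gamma_{lk}^{(m)}=(-1)^k2^{-l}\binom{l}{k}\binom{2l-2k}{l}\frac{(l-2k)!}{(l-2k-m)!}.$$ 2-forms (closed for $\boldsymbol r\neq\boldsymbol r'$, and exact on the contractible patch): $$\chi^{(l,m)}(\boldsymbol r',\boldsymbol r)=\left(G(\boldsymbol r',\boldsymbol r)\nabla H^{(l,m)}(\boldsymbol r)-H^{(l,m)}(\boldsymbol r)\nabla G(\boldsymbol r',\boldsymbol r)\right)\cdot\boldsymbol\nu(\boldsymbol r)\,da(\boldsymbol r),$$ $$\alpha^{(l,m)}(\boldsymbol r',\boldsymbol r)=(0,\nabla G(\boldsymbol r',\boldsymbol r))(0,\boldsymbol\nu(\boldsymbol r))(0,\nabla H^{(l,m)}(\boldsymbol r))\,da(\boldsymbol r).$$ *)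

theory Defs
  imports "HOL-Complex_Analysis.Complex_Analysis"
begin

section \<open>Quaternions\<close>

text \<open>A quaternion is written as the pair of its scalar and its vector part. Sums, real multiples,
  norm, derivatives and integrals are those of the product space, hence componentwise; the scalar
  part is \<^term>\<open>fst\<close>.\<close>

type_synonym quat = "real \<times> (real ^ 3)"

definition qmult :: "quat \<Rightarrow> quat \<Rightarrow> quat" (infixl \<open>\<star>\<close> 70) where
  "f \<star> g = (fst f * fst g - snd f \<bullet> snd g,
            fst f *\<^sub>R snd g + fst g *\<^sub>R snd f + cross3 (snd f) (snd g))"


section \<open>Differentiability classes and gradient\<close>

text \<open>Only meaningful for open \<open>U\<close>: all iterated directional derivatives up to order \<open>k\<close> exist
  (as Frechet derivatives) and are continuous.\<close>

primrec Ck_on :: "nat \<Rightarrow> 'a::euclidean_space set \<Rightarrow> ('a \<Rightarrow> 'b::real_normed_vector) \<Rightarrow> bool" where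
  "Ck_on 0 U f \<longleftrightarrow> continuous_on U f"
| "Ck_on (Suc k) U f \<longleftrightarrow>
     (\<forall>x\<in>U. f differentiable (at x)) \<and> (\<forall>v. Ck_on k U (\<lambda>x. frechet_derivative f (at x) v))"

definition smooth_on :: "'a::euclidean_space set \<Rightarrow> ('a \<Rightarrow> 'b::real_normed_vector) \<Rightarrow> bool" where
  "smooth_on U f \<longleftrightarrow> (\<forall>k. Ck_on k U f)"

definition grad :: "(real ^ 3 \<Rightarrow> real) \<Rightarrow> real ^ 3 \<Rightarrow> real ^ 3" where
  "grad f r = (\<chi> i. frechet_derivative f (at r) (axis i 1))"


section \<open>Oriented surface patches\<close>

text \<open>A patch is the image of a compact region of the parameter plane under a regular injective
  smooth parametrization. The parameter plane $R^2$ is represented by the type \<^typ>\<open>complex\<close> (first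
  coordinate \<^term>\<open>Re\<close>, second coordinate \<^term>\<open>Im\<close>), for which Jordan curves and winding numbers
  are available. The region consists of a simple closed piecewise $C^1$ curve \<open>\<gamma>\<close> and its inside,
  and \<open>\<gamma>\<close> runs counterclockwise.\<close>

definition region :: "(real \<Rightarrow> complex) \<Rightarrow> complex set" where
  "region \<gamma> = path_image \<gamma> \<union> inside (path_image \<gamma>)"

definition patch :: "(complex \<Rightarrow> real ^ 3) \<Rightarrow> (real \<Rightarrow> complex) \<Rightarrow> (real ^ 3) set" where
  "patch \<Phi> \<gamma> = \<Phi> ` region \<gamma>"

definition tangent1 :: "(complex \<Rightarrow> real ^ 3) \<Rightarrow> complex \<Rightarrow> real ^ 3" where
  "tangent1 \<Phi> u = frechet_derivative \<Phi> (at u) 1"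

definition tangent2 :: "(complex \<Rightarrow> real ^ 3) \<Rightarrow> complex \<Rightarrow> real ^ 3" where
  "tangent2 \<Phi> u = frechet_derivative \<Phi> (at u) \<i>"

text \<open>The Lipschitz condition bounds the derivative of \<open>\<gamma>\<close> near its finitely many break points;
  \<^const>\<open>valid_path\<close> alone would admit curves of infinite length. Corners and even cusps of the
  boundary are allowed.\<close>

definition surface_patch :: "(complex \<Rightarrow> real ^ 3) \<Rightarrow> (real \<Rightarrow> complex) \<Rightarrow> bool" where
  "surface_patch \<Phi> \<gamma> \<longleftrightarrow>
     simple_path \<gamma> \<and> pathfinish \<gamma> = pathstart \<gamma> \<and>
     valid_path \<gamma> \<and> (\<exists>L. L-lipschitz_on {0..1} \<gamma>) \<and>
     (\<forall>z \<in> inside (path_image \<gamma>). winding_number \<gamma> z = 1) \<and>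
     (\<exists>U. open U \<and> region \<gamma> \<subseteq> U \<and> smooth_on U \<Phi> \<and> inj_on \<Phi> U \<and>
          (\<forall>u\<in>U. cross3 (tangent1 \<Phi> u) (tangent2 \<Phi> u) \<noteq> 0))"

text \<open>The unit normal as a function of the point of the patch. Together with the counterclockwise
  \<open>\<gamma>\<close> this is the orientation convention of Stokes' theorem; the opposite orientation of the same
  surface is obtained by composing \<open>\<Phi>\<close> and \<open>\<gamma>\<close> with complex conjugation and reversing the curve.\<close>

definition normal :: "(complex \<Rightarrow> real ^ 3) \<Rightarrow> (real \<Rightarrow> complex) \<Rightarrow> real ^ 3 \<Rightarrow> real ^ 3" where
  "normal \<Phi> \<gamma> r =
     (let u = inv_into (region \<gamma>) \<Phi> r in sgn (cross3 (tangent1 \<Phi> u) (tangent2 \<Phi> u)))"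

definition area_density :: "(complex \<Rightarrow> real ^ 3) \<Rightarrow> complex \<Rightarrow> real" where
  "area_density \<Phi> u = norm (cross3 (tangent1 \<Phi> u) (tangent2 \<Phi> u))"

definition surface_integrable ::
  "(complex \<Rightarrow> real ^ 3) \<Rightarrow> (real \<Rightarrow> complex) \<Rightarrow> (real ^ 3 \<Rightarrow> 'b::euclidean_space) \<Rightarrow> bool" where
  "surface_integrable \<Phi> \<gamma> f \<longleftrightarrow>
     (\<lambda>u. area_density \<Phi> u *\<^sub>R f (\<Phi> u)) absolutely_integrable_on region \<gamma>"

definition surface_integral ::
  "(complex \<Rightarrow> real ^ 3) \<Rightarrow> (real \<Rightarrow> complex) \<Rightarrow> (real ^ 3 \<Rightarrow> 'b::euclidean_space) \<Rightarrow> 'b" where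
  "surface_integral \<Phi> \<gamma> f = integral (region \<gamma>) (\<lambda>u. area_density \<Phi> u *\<^sub>R f (\<Phi> u))"


section \<open>Differential forms on a patch\<close>

text \<open>A 1-form assigns to a point \<open>r\<close> of the patch a linear functional, a 2-form an alternating
  bilinear one. They are written as functions of ambient tangent vectors, but only their values
  on vectors tangent to the patch matter. Values are real or quaternions.\<close>

definition area_form ::
  "(complex \<Rightarrow> real ^ 3) \<Rightarrow> (real \<Rightarrow> complex) \<Rightarrow> real ^ 3 \<Rightarrow> real ^ 3 \<Rightarrow> real ^ 3 \<Rightarrow> real" where
  "area_form \<Phi> \<gamma> r v w = normal \<Phi> \<gamma> r \<bullet> cross3 v w"

text \<open>\<open>\<omega>\<close> is a continuously differentiable 1-form on the patch and $d\omega = \tau$ there. The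
  pullback of \<open>\<omega>\<close> along \<open>\<Phi>\<close> is $A\,du_1 + B\,du_2$, with exterior derivative
  $(\partial_1 B - \partial_2 A)\,du_1 \wedge du_2$; being $C^1$ up to the boundary means that the
  coefficients extend to $C^1$ functions on a neighbourhood of the closed parameter region.\<close>

definition is_exterior_derivative ::
  "(complex \<Rightarrow> real ^ 3) \<Rightarrow> (real \<Rightarrow> complex) \<Rightarrow>
   (real ^ 3 \<Rightarrow> real ^ 3 \<Rightarrow> 'b::euclidean_space) \<Rightarrow>
   (real ^ 3 \<Rightarrow> real ^ 3 \<Rightarrow> real ^ 3 \<Rightarrow> 'b) \<Rightarrow> bool" where
  "is_exterior_derivative \<Phi> \<gamma> \<omega> \<tau> \<longleftrightarrow>
     (\<forall>r \<in> patch \<Phi> \<gamma>. linear (\<omega> r)) \<and>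
     (\<exists>V A B. open V \<and> region \<gamma> \<subseteq> V \<and> Ck_on 1 V A \<and> Ck_on 1 V B \<and>
        (\<forall>u \<in> region \<gamma>.
           \<omega> (\<Phi> u) (tangent1 \<Phi> u) = A u \<and> \<omega> (\<Phi> u) (tangent2 \<Phi> u) = B u \<and>
           \<tau> (\<Phi> u) (tangent1 \<Phi> u) (tangent2 \<Phi> u) =
             frechet_derivative B (at u) 1 - frechet_derivative A (at u) \<i>))"

definition boundary_integral ::
  "(complex \<Rightarrow> real ^ 3) \<Rightarrow> (real \<Rightarrow> complex) \<Rightarrow>
   (real ^ 3 \<Rightarrow> real ^ 3 \<Rightarrow> 'b::euclidean_space) \<Rightarrow> 'b" where
  "boundary_integral \<Phi> \<gamma> \<omega> =
     integral {0..1}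
       (\<lambda>t. \<omega> (\<Phi> (\<gamma> t)) (vector_derivative (\<Phi> \<circ> \<gamma>) (at t within {0..1})))"


section \<open>Kernel and harmonic polynomials\<close>

definition green :: "real ^ 3 \<Rightarrow> real ^ 3 \<Rightarrow> real" where
  "green r' r = 1 / (4 * pi * norm (r' - r))"

definition gamma_coeff :: "nat \<Rightarrow> nat \<Rightarrow> nat \<Rightarrow> real" where
  "gamma_coeff l m k =
     (-1) ^ k * (1 / 2 ^ l) * real (l choose k) * real ((2 * l - 2 * k) choose l) *
     (fact (l - 2 * k) / fact (l - 2 * k - m))"

definition Pi_poly :: "nat \<Rightarrow> nat \<Rightarrow> real \<Rightarrow> real \<Rightarrow> real" where
  "Pi_poly l m x s =
     (\<Sum>k = 0..(l - m) div 2. gamma_coeff l m k * s ^ (2 * k) * x ^ (l - 2 * k - m))"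

text \<open>The complex number below is real.\<close>

definition B_poly :: "nat \<Rightarrow> real \<Rightarrow> real \<Rightarrow> real" where
  "B_poly m y z =
     Re (1 / (2 * \<i>) * ((of_real y + \<i> * of_real z) ^ m - (of_real y - \<i> * of_real z) ^ m))"

definition H :: "nat \<Rightarrow> nat \<Rightarrow> real ^ 3 \<Rightarrow> real" where
  "H l m r = sqrt (2 * fact (l - m) / fact (l + m)) *
     Pi_poly l m (r $ 1) (norm r) * B_poly m (r $ 2) (r $ 3)"


section \<open>The 2-forms, layer potentials and approximations\<close>

definition chi_form ::
  "(complex \<Rightarrow> real ^ 3) \<Rightarrow> (real \<Rightarrow> complex) \<Rightarrow> real ^ 3 \<Rightarrow> nat \<Rightarrow> nat \<Rightarrow>
   real ^ 3 \<Rightarrow> real ^ 3 \<Rightarrow> real ^ 3 \<Rightarrow> real" where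
  "chi_form \<Phi> \<gamma> r' l m r v w =
     ((green r' r *\<^sub>R grad (H l m) r - H l m r *\<^sub>R grad (green r') r) \<bullet> normal \<Phi> \<gamma> r) *
     area_form \<Phi> \<gamma> r v w"

definition alpha_form ::
  "(complex \<Rightarrow> real ^ 3) \<Rightarrow> (real \<Rightarrow> complex) \<Rightarrow> real ^ 3 \<Rightarrow> nat \<Rightarrow> nat \<Rightarrow>
   real ^ 3 \<Rightarrow> real ^ 3 \<Rightarrow> real ^ 3 \<Rightarrow> quat" where
  "alpha_form \<Phi> \<gamma> r' l m r v w =
     area_form \<Phi> \<gamma> r v w *\<^sub>R
     ((0, grad (green r') r) \<star> (0, normal \<Phi> \<gamma> r) \<star> (0, grad (H l m) r))"

definition single_layer ::
  "(complex \<Rightarrow> real ^ 3) \<Rightarrow> (real \<Rightarrow> complex) \<Rightarrow> (real ^ 3 \<Rightarrow> real) \<Rightarrow> real ^ 3 \<Rightarrow> real" where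
  "single_layer \<Phi> \<gamma> \<sigma> r' = surface_integral \<Phi> \<gamma> (\<lambda>r. green r' r * \<sigma> r)"

text \<open>For \<open>q = (\<rho>, 0)\<close> the scalar part is minus the Laplace double layer potential of \<open>\<rho>\<close>.\<close>

definition quat_layer ::
  "(complex \<Rightarrow> real ^ 3) \<Rightarrow> (real \<Rightarrow> complex) \<Rightarrow> (real ^ 3 \<Rightarrow> quat) \<Rightarrow> real ^ 3 \<Rightarrow> quat" where
  "quat_layer \<Phi> \<gamma> q r' =
     surface_integral \<Phi> \<gamma> (\<lambda>r. (0, grad (green r') r) \<star> (0, normal \<Phi> \<gamma> r) \<star> q r)"

definition sigma_approx ::
  "(complex \<Rightarrow> real ^ 3) \<Rightarrow> (real \<Rightarrow> complex) \<Rightarrow> nat \<Rightarrow> (nat \<Rightarrow> nat \<Rightarrow> real) \<Rightarrow> real ^ 3 \<Rightarrow> real" where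
  "sigma_approx \<Phi> \<gamma> p d r =
     (\<Sum>l = 1..p. \<Sum>m = 1..l. (grad (H l m) r \<bullet> normal \<Phi> \<gamma> r) * d l m)"

definition rho :: "nat \<Rightarrow> (nat \<Rightarrow> nat \<Rightarrow> real) \<Rightarrow> real ^ 3 \<Rightarrow> real" where
  "rho p d r = (\<Sum>l = 1..p. \<Sum>m = 1..l. H l m r * d l m)"

definition rho_approx :: "nat \<Rightarrow> (nat \<Rightarrow> nat \<Rightarrow> quat) \<Rightarrow> real ^ 3 \<Rightarrow> quat" where
  "rho_approx p g r = (\<Sum>l = 1..p. \<Sum>m = 1..l. (0, grad (H l m) r) \<star> g l m)"

definition one_form_sum ::
  "(complex \<Rightarrow> real ^ 3) \<Rightarrow> (real \<Rightarrow> complex) \<Rightarrow> nat \<Rightarrow>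
   (nat \<Rightarrow> nat \<Rightarrow> real ^ 3 \<Rightarrow> real ^ 3 \<Rightarrow> real) \<Rightarrow> (nat \<Rightarrow> nat \<Rightarrow> real) \<Rightarrow>
   (nat \<Rightarrow> nat \<Rightarrow> real ^ 3 \<Rightarrow> real ^ 3 \<Rightarrow> quat) \<Rightarrow> (nat \<Rightarrow> nat \<Rightarrow> quat) \<Rightarrow> real" where
  "one_form_sum \<Phi> \<gamma> p \<psi> d \<beta> g =
     (\<Sum>l = 1..p. \<Sum>m = 1..l.
        boundary_integral \<Phi> \<gamma> (\<lambda>r v. \<psi> l m r v * d l m - fst (\<beta> l m r v \<star> g l m)))"

end

theory Submission
  imports Defs
begin

text \<open>With \<open>q = (0, \<nabla>G) (0, \<nu>)\<close> one has \<open>[q (\<rho>, 0)]\<^sub>0 = - \<rho> \<nabla>G \<bullet> \<nu>\<close>, so the sum of the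
  forms \<open>\<chi> d - [\<alpha> g]\<^sub>0\<close> integrates \<open>G \<sigma>\<close> with \<open>\<sigma>\<close> approximated, plus the scalar part of \<open>q\<close> times the
  error of \<open>\<rho>\<close>; Stokes' theorem turns its integral into the boundary integral. Pulled back to the
  parameter plane, Stokes' theorem is Green's theorem for a Jordan curve that is only Lipschitz and
  piecewise $C^1$: by the Cauchy-Pompeiu formula a $C^1$ function of compact support is
  $f(w) = -\frac{1}{\pi} \int \frac{\bar\partial f(z)}{z - w}\, dz$, so Fubini's theorem gives
  $\oint_\gamma f = 2i \int \bar\partial f \cdot n_\gamma$ with $n_\gamma$ the winding number. Every 2-form on
  the plane has a primitive \<open>B du\<^sub>2\<close>, found by integrating along the first coordinate after a cutoff.\<close>

section \<open>Functions of class C1\<close>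

text \<open>Nothing is known about how the boundary curve meets horizontal and vertical lines, and
  it may have cusps, so the region cannot be cut into graph-like pieces for Green's theorem. The
  route through the Cauchy kernel sees the geometry only through winding numbers. It rests on two
  analytic inputs: 1/|z| is locally integrable in the plane, and the Lipschitz bound on the curve
  bounds its velocity. Together they make the double integral over curve and plane absolutely
  convergent, as Fubini's theorem requires. A 2-form on a surface has top degree, so no closedness
  condition arises for the primitives. In parameter coordinates the area density cancels the
  normalization of the normal, and what remains is of class C1 near the closed region.\<close>

lemma C1I:
  assumes "\<And>x. x \<in> V \<Longrightarrow> (f has_derivative f' x) (at x)"
    and "\<And>v. continuous_on V (\<lambda>x. f' x v)"
  shows "Ck_on 1 V f"
proof -
  have "frechet_derivative f (at x) = f' x" if "x \<in> V" for x
    using frechet_derivative_at[OF assms(1)[OF that]] by simp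
  then have "continuous_on V (\<lambda>x. frechet_derivative f (at x) v)" for v
    using assms(2)[of v] by (simp cong: continuous_on_cong)
  then show ?thesis
    using assms(1) by (auto simp: differentiable_def)
qed

lemma C1_has_derivative:
  assumes "Ck_on 1 V f" "x \<in> V"
  shows "(f has_derivative frechet_derivative f (at x)) (at x)"
  using assms by (simp add: frechet_derivative_works[symmetric])

lemma C1_continuous_derivative:
  assumes "Ck_on 1 V f"
  shows "continuous_on V (\<lambda>x. frechet_derivative f (at x) v)"
  using assms by simp

lemma C1_continuous:
  assumes "Ck_on 1 V f"
  shows "continuous_on V f"
  using assms by (auto intro!: continuous_at_imp_continuous_on differentiable_imp_continuous_within)

lemma C1_subset:
  assumes "Ck_on 1 V f" "W \<subseteq> V"
  shows "Ck_on 1 W f"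
  using assms by (auto intro: continuous_on_subset)

text \<open>Openness of \<open>V\<close> matters: the derivative at a point depends on the values
  around it.\<close>

lemma C1_cong:
  assumes "open V" and "Ck_on 1 V f" and eq: "\<And>x. x \<in> V \<Longrightarrow> f x = g x"
  shows "Ck_on 1 V g"
proof (rule C1I)
  fix x assume "x \<in> V"
  with assms show "(g has_derivative frechet_derivative f (at x)) (at x)"
    by (metis C1_has_derivative has_derivative_transform_within_open)
next
  show "continuous_on V (\<lambda>x. frechet_derivative f (at x) v)" for v
    using assms(2) by (rule C1_continuous_derivative)
qed

lemma C1_bounded_linear:
  assumes "bounded_linear h" "Ck_on 1 V f"
  shows "Ck_on 1 V (\<lambda>x. h (f x))"
  using assms
  by (intro C1I[where f' = "\<lambda>x v. h (frechet_derivative f (at x) v)"]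
      bounded_linear.has_derivative[OF assms(1)] C1_has_derivative
      bounded_linear.continuous_on[OF assms(1)] C1_continuous_derivative) auto

lemma C1_bounded_bilinear:
  assumes "bounded_bilinear h" "Ck_on 1 V f" "Ck_on 1 V g"
  shows "Ck_on 1 V (\<lambda>x. h (f x) (g x))"
  using assms
  by (intro C1I[where f' = "\<lambda>x v. h (f x) (frechet_derivative g (at x) v)
                   + h (frechet_derivative f (at x) v) (g x)"]
      bounded_bilinear.FDERIV[OF assms(1)] C1_has_derivative continuous_on_add
      bounded_bilinear.continuous_on[OF assms(1)] C1_continuous_derivative C1_continuous) auto

lemma C1_const: "Ck_on 1 V (\<lambda>x. c)"
  by (rule C1I[where f' = "\<lambda>x v. 0"]) auto

lemma C1_linear: "bounded_linear h \<Longrightarrow> Ck_on 1 V h"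
  by (rule C1I[where f' = "\<lambda>x. h"]) (auto intro: bounded_linear_imp_has_derivative)

lemma C1_add:
  assumes "Ck_on 1 V f" "Ck_on 1 V g"
  shows "Ck_on 1 V (\<lambda>x. f x + g x)"
  by (rule C1I[where f' = "\<lambda>x v. frechet_derivative f (at x) v + frechet_derivative g (at x) v"])
    (use assms in \<open>intro has_derivative_add C1_has_derivative continuous_on_add C1_continuous_derivative; simp\<close>)+

lemma C1_minus:
  assumes "Ck_on 1 V f"
  shows "Ck_on 1 V (\<lambda>x. - f x)"
  by (rule C1_bounded_linear[OF bounded_linear_minus[OF bounded_linear_ident] assms])

lemma C1_diff:
  assumes "Ck_on 1 V f" "Ck_on 1 V g"
  shows "Ck_on 1 V (\<lambda>x. f x - g x)"
  using C1_add[OF assms(1) C1_minus[OF assms(2)]] by simp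

lemma C1_sum:
  assumes "\<And>i. i \<in> I \<Longrightarrow> Ck_on 1 V (f i)"
  shows "Ck_on 1 V (\<lambda>x. \<Sum>i\<in>I. f i x)"
  using assms by (induction I rule: infinite_finite_induct) (auto intro!: C1_const C1_add simp del: Ck_on.simps One_nat_def)

lemma C1_vector:
  fixes f :: "'a::euclidean_space \<Rightarrow> real ^ 'n"
  assumes "\<And>i. Ck_on 1 V (\<lambda>x. f x $ i)"
  shows "Ck_on 1 V f"
proof -
  have "Ck_on 1 V (\<lambda>x. \<Sum>i\<in>UNIV. f x $ i *\<^sub>R axis i (1::real))"
    by (intro C1_sum C1_bounded_linear[OF bounded_linear_scaleR_left] assms)
  then show ?thesis
    by (simp add: scalar_mult_eq_scaleR[symmetric] basis_expansion del: Ck_on.simps One_nat_def)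
qed

lemma C1_compose:
  fixes f :: "'a::euclidean_space \<Rightarrow> 'b::euclidean_space"
  assumes g: "Ck_on 1 W g" and f: "Ck_on 1 V f" and fV: "f ` V \<subseteq> W"
  shows "Ck_on 1 V (\<lambda>x. g (f x))"
proof (rule C1I)
  fix x assume x: "x \<in> V"
  have "(g has_derivative frechet_derivative g (at (f x))) (at (f x))"
    using g fV x by (auto intro: C1_has_derivative simp del: Ck_on.simps One_nat_def)
  then show "((\<lambda>x. g (f x)) has_derivative
      (\<lambda>v. frechet_derivative g (at (f x)) (frechet_derivative f (at x) v))) (at x)"
    by (rule has_derivative_compose[OF C1_has_derivative[OF f x]])
next
  fix v
  have lin: "linear (frechet_derivative g (at (f x)))" if "x \<in> V" for x
    using g fV that by (auto intro!: linear_frechet_derivative)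
  \<comment> \<open>The direction \<open>frechet_derivative f (at x) v\<close> moves with
    \<open>x\<close>, whereas continuity of the derivative of \<open>g\<close> is known for fixed
    directions only; hence the expansion in the basis.\<close>
  have "continuous_on V (\<lambda>x. \<Sum>b\<in>Basis. (frechet_derivative f (at x) v \<bullet> b) *\<^sub>R
      frechet_derivative g (at (f x)) b)"
    by (intro continuous_on_sum continuous_on_scaleR continuous_on_inner continuous_on_const
        C1_continuous_derivative[OF f]
        continuous_on_compose2[OF C1_continuous_derivative[OF g] C1_continuous[OF f] fV])
  moreover have "(\<Sum>b\<in>Basis. (frechet_derivative f (at x) v \<bullet> b) *\<^sub>R
      frechet_derivative g (at (f x)) b) =
      frechet_derivative g (at (f x)) (frechet_derivative f (at x) v)" if "x \<in> V" for x
    using arg_cong[OF euclidean_representation[of "frechet_derivative f (at x) v"],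
        of "frechet_derivative g (at (f x))"] lin[OF that]
    by (simp add: linear_sum linear_scale)
  ultimately show "continuous_on V
      (\<lambda>x. frechet_derivative g (at (f x)) (frechet_derivative f (at x) v))"
    by (simp cong: continuous_on_cong)
qed

lemmas C1_mult = C1_bounded_bilinear[OF bounded_bilinear_mult]
lemmas C1_scaleR = C1_bounded_bilinear[OF bounded_bilinear_scaleR]
lemmas C1_inner = C1_bounded_bilinear[OF bounded_bilinear_inner]

lemma C1_inverse:
  fixes f :: "'a::euclidean_space \<Rightarrow> real"
  assumes f: "Ck_on 1 V f" and nz: "\<And>x. x \<in> V \<Longrightarrow> f x \<noteq> 0"
  shows "Ck_on 1 V (\<lambda>x. inverse (f x))"
proof (rule C1I)
  show "((\<lambda>x. inverse (f x)) has_derivative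
     (\<lambda>v. - (inverse (f x) * frechet_derivative f (at x) v * inverse (f x)))) (at x)"
    if "x \<in> V" for x
    using Deriv.has_derivative_inverse[OF nz[OF that] C1_has_derivative[OF f that]] .
  show "continuous_on V (\<lambda>x. - (inverse (f x) * frechet_derivative f (at x) v * inverse (f x)))" for v
    by (intro continuous_intros C1_continuous[OF f] C1_continuous_derivative[OF f]) (use nz in auto)
qed

lemma C1_power:
  fixes f :: "'a::euclidean_space \<Rightarrow> real"
  assumes "Ck_on 1 V f"
  shows "Ck_on 1 V (\<lambda>x. f x ^ n)"
  by (induction n) (auto intro!: C1_const C1_mult assms simp del: Ck_on.simps One_nat_def)

lemma C1_norm:
  fixes f :: "'a::euclidean_space \<Rightarrow> 'b::euclidean_space"
  assumes f: "Ck_on 1 V f" and nz: "\<And>x. x \<in> V \<Longrightarrow> f x \<noteq> 0"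
  shows "Ck_on 1 V (\<lambda>x. norm (f x))"
proof (rule C1I)
  show "((\<lambda>x. norm (f x)) has_derivative
     (\<lambda>v. sgn (f x) \<bullet> frechet_derivative f (at x) v)) (at x)"
    if "x \<in> V" for x
    using has_derivative_compose[OF C1_has_derivative[OF f that] has_derivative_norm[OF nz[OF that]]]
    by (simp add: inner_commute)
  show "continuous_on V (\<lambda>x. sgn (f x) \<bullet> frechet_derivative f (at x) v)" for v
    unfolding sgn_div_norm
    by (intro continuous_intros C1_continuous[OF f] C1_continuous_derivative[OF f]) (use nz in auto)
qed

text \<open>Closure under directional derivatives is carried along so that class C1 follows for the
  partial derivatives of a polynomial as well, as needed for the gradient of
  \<open>H l m\<close>.\<close>

lemma real_polynomial_function_derivative:
  assumes "real_polynomial_function f"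
  shows "(\<forall>x. f differentiable (at x)) \<and>
    (\<forall>v. real_polynomial_function (\<lambda>x. frechet_derivative f (at x) v))"
  using assms
proof (induction f)
  case (linear f)
  then have "frechet_derivative f (at x) = f" for x
    by (metis bounded_linear_imp_has_derivative frechet_derivative_at)
  with linear show ?case
    by (auto intro!: real_polynomial_function.intros(2) bounded_linear_imp_differentiable)
next
  case (const c)
  then show ?case by (auto simp: frechet_derivative_const intro: real_polynomial_function.intros)
next
  case (add f g)
  have "((\<lambda>x. f x + g x) has_derivative
      (\<lambda>v. frechet_derivative f (at x) v + frechet_derivative g (at x) v)) (at x)" for x
    using add.IH by (intro has_derivative_add) (auto simp: frechet_derivative_works[symmetric])
  from frechet_derivative_at[OF this, symmetric] add.IH show ?case
    by (auto simp: fun_eq_iff intro: real_polynomial_function.intros)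
next
  case (mult f g)
  have "((\<lambda>x. f x * g x) has_derivative
      (\<lambda>v. f x * frechet_derivative g (at x) v + frechet_derivative f (at x) v * g x)) (at x)" for x
    using mult.IH by (intro has_derivative_mult) (auto simp: frechet_derivative_works[symmetric])
  from frechet_derivative_at[OF this, symmetric] mult.IH mult.hyps show ?case
    by (auto simp: fun_eq_iff intro!: real_polynomial_function.intros(3,4))
qed

lemma C1_real_polynomial_function:
  assumes "real_polynomial_function f"
  shows "Ck_on 1 V f"
  using real_polynomial_function_derivative[OF assms]
  by (auto simp: real_polynomial_function_eq intro!: continuous_on_polymonial_function)

section \<open>Cutoff functions of class C1\<close>

lemma C1_square_pos_part: "Ck_on 1 V (\<lambda>s::real. (max 0 s)\<^sup>2)"
proof (rule C1I)
  fix x :: real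
  \<comment> \<open>The squared positive part is half of s^2 + s |s|, so only s |s| needs care, and
    only at 0, where its difference quotient is |h|.\<close>
  have D: "((\<lambda>s. s * \<bar>s\<bar>) has_real_derivative 2 * \<bar>x\<bar>) (at x)"
  proof (cases "x = 0")
    case True
    have "((\<lambda>h::real. \<bar>h\<bar>) \<longlongrightarrow> 0) (at 0)"
      using tendsto_rabs[OF tendsto_ident_at, of "0::real" UNIV] by simp
    then show ?thesis unfolding True DERIV_def
      by (rule filterlim_mono_eventually) (auto simp: eventually_at_filter)
  next
    case False
    then have "((\<lambda>s. s * \<bar>s\<bar>) has_derivative (\<lambda>v. x * (v * sgn x) + v * \<bar>x\<bar>)) (at x)"
      using has_derivative_mult[OF has_derivative_ident has_derivative_norm[OF False]]
      by simp
    moreover have "(\<lambda>v. x * (v * sgn x) + v * \<bar>x\<bar>) = (*) (2 * \<bar>x\<bar>)"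
      by (auto simp: fun_eq_iff abs_if sgn_if)
    ultimately show ?thesis by (simp add: has_field_derivative_def)
  qed
  have "((\<lambda>s. (s\<^sup>2 + s * \<bar>s\<bar>) / 2) has_real_derivative x + \<bar>x\<bar>) (at x)"
    by (rule derivative_eq_intros D refl | simp)+
  moreover have "(\<lambda>s::real. (s\<^sup>2 + s * \<bar>s\<bar>) / 2) = (\<lambda>s. (max 0 s)\<^sup>2)"
    by (auto simp: max_def power2_eq_square abs_if fun_eq_iff)
  ultimately show "((\<lambda>s. (max 0 s)\<^sup>2) has_derivative (\<lambda>v. (x + \<bar>x\<bar>) * v)) (at x)"
    by (simp add: has_field_derivative_def)
qed (intro continuous_intros)

lemma C1_bump_ball:
  fixes c :: "'a::euclidean_space"
  assumes "e > 0"
  obtains f :: "'a \<Rightarrow> real" where "Ck_on 1 UNIV f"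
    "\<And>x. x \<in> cball c e \<Longrightarrow> f x = 1" "\<And>x. x \<notin> ball c (2 * e) \<Longrightarrow> f x = 0"
proof
  \<comment> \<open>The squared distance is polynomial, hence of class C1 at the centre too. With
    this scaling \<open>s\<close> is at most 0 on the small ball and at least 3 outside the doubled
    one, while the profile in \<open>?f\<close> already falls from 1 to 0 as \<open>s\<close> goes
    from 0 to 1.\<close>
  define s where "s x = ((x - c) \<bullet> (x - c) - e\<^sup>2) / e\<^sup>2" for x
  let ?f = "\<lambda>x. (max 0 (1 - (max 0 (s x))\<^sup>2))\<^sup>2"
  have s: "Ck_on 1 UNIV s"
    unfolding s_def divide_inverse
    by (intro C1_mult C1_diff C1_inner C1_linear[OF bounded_linear_ident] C1_const)
  have "Ck_on 1 UNIV (\<lambda>x. 1 - (max 0 (s x))\<^sup>2)"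
    by (intro C1_diff C1_const C1_compose[OF C1_square_pos_part s]) auto
  then show "Ck_on 1 UNIV ?f"
    by (rule C1_compose[OF C1_square_pos_part]) auto
  have s': "s x = (dist c x)\<^sup>2 / e\<^sup>2 - 1" for x
    using assms by (simp add: s_def dot_square_norm dist_norm norm_minus_commute field_simps)
  show "?f x = 1" if "x \<in> cball c e" for x
  proof -
    have "(dist c x)\<^sup>2 \<le> e\<^sup>2" using that by (intro power_mono) auto
    then have "s x \<le> 0" using assms by (simp add: s' field_simps)
    then show ?thesis by simp
  qed
  show "?f x = 0" if "x \<notin> ball c (2 * e)" for x
  proof -
    have "(2 * e)\<^sup>2 \<le> (dist c x)\<^sup>2" using that assms by (intro power_mono) auto
    then have "1 \<le> s x" using assms
      by (simp add: s' le_divide_eq power_mult_distrib) (smt (verit) zero_le_power2)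
    then have "1 \<le> (max 0 (s x))\<^sup>2" by (simp add: one_le_power)
    then show ?thesis by simp
  qed
qed

lemma C1_prod:
  fixes f :: "'i \<Rightarrow> 'a::euclidean_space \<Rightarrow> real"
  assumes "\<And>i. i \<in> I \<Longrightarrow> Ck_on 1 V (f i)"
  shows "Ck_on 1 V (\<lambda>x. \<Prod>i\<in>I. f i x)"
  using assms by (induction I rule: infinite_finite_induct) (auto intro!: C1_const C1_mult simp del: Ck_on.simps One_nat_def)

text \<open>The value 1 is attained on a neighbourhood \<open>W\<close> of \<open>K\<close> and not
  merely on \<open>K\<close>, so that multiplication by the cutoff leaves derivatives on
  \<open>K\<close> unchanged. The compact set \<open>L\<close> inside \<open>V\<close> allows
  functions given on \<open>V\<close> to be extended by zero.\<close>

lemma C1_cutoff: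
  fixes K :: "'a::euclidean_space set"
  assumes K: "compact K" and V: "open V" "K \<subseteq> V"
  obtains \<eta> :: "'a \<Rightarrow> real" and W L where "Ck_on 1 UNIV \<eta>" "open W" "K \<subseteq> W"
    "\<And>x. x \<in> W \<Longrightarrow> \<eta> x = 1" "compact L" "L \<subseteq> V" "\<And>x. x \<notin> L \<Longrightarrow> \<eta> x = 0"
proof -
  have "\<exists>e>0. cball x (2 * e) \<subseteq> V" if x: "x \<in> K" for x
  proof -
    obtain e where "e > 0" "cball x e \<subseteq> V"
      using V x open_contains_cball by blast
    then show ?thesis by (intro exI[of _ "e/2"]) auto
  qed
  then obtain e :: "'a \<Rightarrow> real" where e: "\<And>x. x \<in> K \<Longrightarrow> e x > 0" "\<And>x. x \<in> K \<Longrightarrow> cball x (2 * e x) \<subseteq> V"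
    using bchoice[of K "\<lambda>x e. e > 0 \<and> cball x (2 * e) \<subseteq> V"] by blast
  have "K \<subseteq> (\<Union>x\<in>K. ball x (e x))" using e(1) centre_in_ball by blast
  then obtain F where F: "F \<subseteq> K" "finite F" "K \<subseteq> (\<Union>x\<in>F. ball x (e x))"
    by (rule compactE_image[OF K, rotated]) auto
  have "\<exists>f. Ck_on 1 UNIV f \<and> (\<forall>y\<in>cball x (e x). f y = (1::real)) \<and> (\<forall>y. y \<notin> ball x (2 * e x) \<longrightarrow> f y = 0)"
    if "x \<in> K" for x
    using C1_bump_ball[OF e(1)[OF that], of x] by metis
  then obtain f where f: "\<And>x. x \<in> K \<Longrightarrow> Ck_on 1 UNIV (f x)"
    "\<And>x y. x \<in> K \<Longrightarrow> y \<in> cball x (e x) \<Longrightarrow> f x y = (1::real)"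
    "\<And>x y. x \<in> K \<Longrightarrow> y \<notin> ball x (2 * e x) \<Longrightarrow> f x y = 0"
    by metis
  show thesis
  proof
    \<comment> \<open>One minus the product of the \<open>1 - f x\<close> is 1 as soon as one bump
      is 1, and 0 where all of them vanish; unlike a partition of unity it involves no
      division.\<close>
    show "Ck_on 1 UNIV (\<lambda>y. 1 - (\<Prod>x\<in>F. 1 - f x y))"
      using f(1) F(1) by (intro C1_diff C1_const C1_prod) auto
    show "open (\<Union>x\<in>F. ball x (e x))" by auto
    show "K \<subseteq> (\<Union>x\<in>F. ball x (e x))" by fact
    show "1 - (\<Prod>x\<in>F. 1 - f x y) = 1" if y: "y \<in> (\<Union>x\<in>F. ball x (e x))" for y
    proof -
      obtain x where "x \<in> F" "y \<in> ball x (e x)" using y by blast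
      with F f(2)[of x y] have "\<exists>x\<in>F. 1 - f x y = 0"
        by (intro bexI[of _ x]) auto
      then show ?thesis using F(2) by (simp add: prod_zero)
    qed
    show "compact (\<Union>x\<in>F. cball x (2 * e x))" using F by (intro compact_UN) auto
    show "(\<Union>x\<in>F. cball x (2 * e x)) \<subseteq> V" using F(1) e(2) by blast
    show "1 - (\<Prod>x\<in>F. 1 - f x y) = 0" if "y \<notin> (\<Union>x\<in>F. cball x (2 * e x))" for y
    proof -
      have "f x y = 0" if "x \<in> F" for x
        using that F(1) \<open>y \<notin> _\<close> by (intro f(3)) auto
      then show ?thesis by simp
    qed
  qed
qed

section \<open>The Cauchy-Pompeiu formula\<close>

lemma frechet_derivative_outside_support:
  fixes f :: "'a::euclidean_space \<Rightarrow> 'b::real_normed_vector"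
  assumes supp: "\<And>z. norm z > R \<Longrightarrow> f z = 0" and z: "norm z > R"
  shows "frechet_derivative f (at z) v = 0"
proof -
  have "(f has_derivative (\<lambda>v. 0)) (at z)"
    by (rule has_derivative_transform_within_open[where s = "- cball 0 R" and f = "\<lambda>_. 0"])
      (use z supp in auto)
  then show ?thesis
    using frechet_derivative_at by metis
qed

text \<open>The derivative vanishes outside a compact ball, so its partial derivatives are bounded
  on the whole space, and the mean value inequality gives the Lipschitz bound. These constants enter
  the majorants for dominated convergence below.\<close>

lemma C1_compact_support_bounds:
  fixes f :: "'a::euclidean_space \<Rightarrow> 'b::real_normed_vector"
  assumes f: "Ck_on 1 UNIV f" and supp: "\<And>z. norm z > R \<Longrightarrow> f z = 0"
  obtains M where "M \<ge> 0" "\<And>z v. norm (frechet_derivative f (at z) v) \<le> M * norm v"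
    "\<And>z w. norm (f z - f w) \<le> M * norm (z - w)"
proof -
  have "\<exists>M\<ge>0. \<forall>z. norm (frechet_derivative f (at z) b) \<le> M" for b
  proof -
    have "compact ((\<lambda>z. frechet_derivative f (at z) b) ` cball 0 R)"
      by (intro compact_continuous_image continuous_on_subset[OF C1_continuous_derivative[OF f]]) auto
    then obtain M where "\<forall>z\<in>cball 0 R. norm (frechet_derivative f (at z) b) \<le> M"
      using compact_imp_bounded bounded_iff by (metis (no_types, lifting) image_eqI)
    then have "norm (frechet_derivative f (at z) b) \<le> max 0 M" for z
      using frechet_derivative_outside_support[of R f z b, OF supp]
      by (cases "norm z > R") (auto simp: le_max_iff_disj)
    then show ?thesis by (meson max.cobounded1)
  qed
  then obtain m where m: "\<And>b. m b \<ge> 0" "\<And>b z. norm (frechet_derivative f (at z) b) \<le> m b"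
    by metis
  define M where "M = (\<Sum>b\<in>(Basis::'a set). m b)"
  have D: "(f has_derivative frechet_derivative f (at z)) (at z)" for z
    using C1_has_derivative[OF f] by simp
  have bound: "norm (frechet_derivative f (at z) v) \<le> M * norm v" for z v
  proof -
    have lin: "linear (frechet_derivative f (at z))"
      using D by (rule has_derivative_linear)
    have "frechet_derivative f (at z) v = (\<Sum>b\<in>Basis. (v \<bullet> b) *\<^sub>R frechet_derivative f (at z) b)"
      using arg_cong[OF euclidean_representation[of v], of "frechet_derivative f (at z)"] lin
      by (simp add: linear_sum linear_scale)
    also have "norm \<dots> \<le> (\<Sum>b\<in>Basis. norm v * m b)"
      by (intro order_trans[OF norm_sum] sum_mono)
        (auto intro!: mult_mono m simp: Basis_le_norm)
    finally show ?thesis by (simp add: M_def sum_distrib_left mult.commute)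
  qed
  show thesis
  proof
    show "M \<ge> 0" unfolding M_def using m by (intro sum_nonneg) auto
    show "norm (frechet_derivative f (at z) v) \<le> M * norm v" for z v by (rule bound)
    show "norm (f z - f w) \<le> M * norm (z - w)" for z w
      by (rule differentiable_bound[OF convex_UNIV]) (use D bound in \<open>auto intro!: onorm_le\<close>)
  qed
qed

lemma integrable_continuous_compact_support:
  fixes f :: "'a::euclidean_space \<Rightarrow> 'b::{banach, second_countable_topology}"
  assumes "continuous_on UNIV f" and supp: "\<And>z. norm z > R \<Longrightarrow> f z = 0"
  shows "integrable lborel f"
proof -
  have "integrable lborel (\<lambda>x. indicator (cball 0 R) x *\<^sub>R f x)"
    using borel_integrable_compact[of "cball 0 R" f] continuous_on_subset[OF assms(1)]
    by (simp add: indicator_scaleR_eq_if)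
  moreover have "indicator (cball 0 R) x *\<^sub>R f x = f x" for x
    using supp[of x] by (auto simp: indicator_def)
  ultimately show ?thesis by simp
qed

lemma integral_lborel_translation:
  fixes f :: "'a::euclidean_space \<Rightarrow> 'b::{banach, second_countable_topology}"
  assumes "f \<in> borel_measurable borel"
  shows "(LINT z|lborel. f (z + w)) = (LINT z|lborel. f z)"
proof -
  have "(LINT z|lborel. f z) = (LINT z|distr lborel borel ((+) w). f z)"
    by (simp add: lborel_distr_plus)
  also have "\<dots> = (LINT z|lborel. f (w + z))"
    by (rule integral_distr) (use assms in auto)
  finally show ?thesis by (simp add: add.commute)
qed

lemma integrable_lborel_translation:
  fixes f :: "'a::euclidean_space \<Rightarrow> 'b::{banach, second_countable_topology}"
  assumes "integrable lborel f"
  shows "integrable lborel (\<lambda>z. f (z + w))"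
proof -
  have "integrable (distr lborel borel ((+) w)) f"
    using assms by (simp add: lborel_distr_plus)
  then have "integrable lborel (\<lambda>z. f (w + z))"
    by (subst (asm) integrable_distr_eq) (use assms in auto)
  then show ?thesis by (simp add: add.commute)
qed

lemma has_vector_derivative_quotient:
  assumes "(f has_vector_derivative D) (at x)"
  shows "((\<lambda>h. (f (x + h) - f x) /\<^sub>R h) \<longlongrightarrow> D) (at 0)"
proof -
  have "((\<lambda>h. norm (f (x + h) - f x - h *\<^sub>R D) / norm h) \<longlongrightarrow> 0) (at 0)"
    using assms by (simp add: has_vector_derivative_def has_derivative_at)
  then have "((\<lambda>h. norm ((f (x + h) - f x) /\<^sub>R h - D)) \<longlongrightarrow> 0) (at 0)"
  proof (rule filterlim_mono_eventually)
    have "norm (a - h *\<^sub>R D) / norm h = norm (a /\<^sub>R h - D)" if "h \<noteq> 0" for h a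
    proof -
      have "a - h *\<^sub>R D = h *\<^sub>R (a /\<^sub>R h - D)"
        using that by (simp add: scaleR_diff_right)
      then show ?thesis using that by (simp only: norm_scaleR) simp
    qed
    then show "\<forall>\<^sub>F h in at 0. norm (f (x + h) - f x - h *\<^sub>R D) / norm h
        = norm ((f (x + h) - f x) /\<^sub>R h - D)"
      by (auto simp: eventually_at_filter)
  qed auto
  then show ?thesis
    by (simp add: tendsto_norm_zero_iff Lim_null[of _ D])
qed

text \<open>The integral of \<open>f\<close> is translation invariant, so its derivative along a translation vanishes.\<close>

lemma integral_derivative_eq_0:
  fixes f :: "'a::euclidean_space \<Rightarrow> 'b::{banach, second_countable_topology}"
  assumes f: "Ck_on 1 UNIV f" and supp: "\<And>z. norm z > R \<Longrightarrow> f z = 0"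
  shows "(LINT z|lborel. frechet_derivative f (at z) v) = 0"
proof -
  obtain M where M: "M \<ge> 0" "\<And>z w. norm (f z - f w) \<le> M * norm (z - w)"
    using C1_compact_support_bounds[OF f supp] by metis
  define q where "q n z = real (Suc n) *\<^sub>R (f (z + v /\<^sub>R real (Suc n)) - f z)" for n z
  have cont: "continuous_on UNIV f" using f by (rule C1_continuous)
  have int: "integrable lborel f"
    by (rule integrable_continuous_compact_support[OF cont supp])
  have meas: "f \<in> borel_measurable borel" using cont by (rule borel_measurable_continuous_onI)
  have "(\<lambda>n. LINT z|lborel. q n z) \<longlonglongrightarrow> (LINT z|lborel. frechet_derivative f (at z) v)"
  \<comment> \<open>The steps \<open>1 / Suc n\<close> are at most 1, so \<open>f\<close> and its
    translate both vanish outside the ball of radius \<open>R + norm v\<close>; inside, the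
    Lipschitz bound controls the quotient.\<close>
  proof (rule integral_dominated_convergence[where w = "\<lambda>z. indicator (cball 0 (R + norm v)) z * (M * norm v)"])
    show "(\<lambda>z. frechet_derivative f (at z) v) \<in> borel_measurable lborel"
      using borel_measurable_continuous_onI[OF C1_continuous_derivative[OF f]] by simp
    show "q n \<in> borel_measurable lborel" for n
      unfolding q_def using meas by measurable
    show "integrable lborel (\<lambda>z::'a. indicator (cball 0 (R + norm v)) z * (M * norm v))"
      by (intro integrable_mult_left integrable_real_indicator) (use emeasure_bounded_finite[OF bounded_cball] in \<open>auto simp: less_top\<close>)
    show "AE z in lborel. (\<lambda>n. q n z) \<longlonglongrightarrow> frechet_derivative f (at z) v"
    proof (rule AE_I2)
      fix z :: 'a
      have "((\<lambda>t. f (z + t *\<^sub>R v)) has_vector_derivative frechet_derivative f (at z) v) (at 0)"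
      proof -
        have "((\<lambda>t. f (z + t *\<^sub>R v)) has_derivative (\<lambda>t. frechet_derivative f (at z) (t *\<^sub>R v))) (at 0)"
          by (rule has_derivative_compose[where f = "\<lambda>t. z + t *\<^sub>R v"])
            (use C1_has_derivative[OF f, of z] in \<open>auto intro!: derivative_eq_intros\<close>)
        then show ?thesis
          using has_derivative_linear[OF C1_has_derivative[OF f, of z]]
          by (simp add: has_vector_derivative_def linear_scale)
      qed
      from has_vector_derivative_quotient[OF this]
      have "((\<lambda>t. (f (z + t *\<^sub>R v) - f z) /\<^sub>R t) \<longlongrightarrow> frechet_derivative f (at z) v) (at 0)"
        by simp
      moreover have "filterlim (\<lambda>n. 1 / real (Suc n)) (at 0) sequentially"
        unfolding filterlim_at by (auto intro!: LIMSEQ_Suc[OF lim_1_over_n, simplified] always_eventually)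
      ultimately have "(\<lambda>n. (f (z + (1 / real (Suc n)) *\<^sub>R v) - f z) /\<^sub>R (1 / real (Suc n)))
          \<longlonglongrightarrow> frechet_derivative f (at z) v"
        by (rule filterlim_compose)
      then show "(\<lambda>n. q n z) \<longlonglongrightarrow> frechet_derivative f (at z) v"
        by (simp add: q_def inverse_eq_divide)
    qed
    show "AE z in lborel. norm (q n z) \<le> indicator (cball 0 (R + norm v)) z * (M * norm v)" for n
    proof (rule AE_I2)
      fix z :: 'a
      have small: "norm (v /\<^sub>R real (Suc n)) \<le> norm v"
        by (simp add: field_simps)
      show "norm (q n z) \<le> indicator (cball 0 (R + norm v)) z * (M * norm v)"
      proof (cases "norm z \<le> R + norm v")
        case True
        have "norm (f (z + v /\<^sub>R real (Suc n)) - f z) \<le> M * norm (v /\<^sub>R real (Suc n))"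
          using M(2)[of "z + v /\<^sub>R real (Suc n)" z] by simp
        then have "norm (q n z) \<le> real (Suc n) * (M * norm (v /\<^sub>R real (Suc n)))"
          unfolding q_def norm_scaleR by (intro mult_mono) auto
        also have "\<dots> = M * norm v" by simp
        finally show ?thesis using True by simp
      next
        case False
        then have "norm z > R" using norm_ge_zero[of v] by linarith
        moreover have "norm (z + v /\<^sub>R real (Suc n)) > R"
          using False small norm_diff_ineq[of z "v /\<^sub>R real (Suc n)"] by linarith
        ultimately show ?thesis using supp M(1) by (simp add: q_def indicator_def)
      qed
    qed
  qed
  moreover have "(LINT z|lborel. q n z) = 0" for n
    unfolding q_def
    using integral_lborel_translation[OF meas, of "v /\<^sub>R real (Suc n)"] int
      integrable_lborel_translation[OF int, of "v /\<^sub>R real (Suc n)"]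
    by simp
  ultimately show ?thesis
    by (simp add: LIMSEQ_const_iff)
qed

section \<open>Local integrability of 1/|z| in the plane\<close>

lemma negligible_imp_AE_lborel: "negligible S \<Longrightarrow> AE x in lborel. x \<notin> S"
  by (metis AE_completion_iff AE_not_in negligible_iff_null_sets)

text \<open>This is the one-dimensional factor of a product majorant for 1/|z|, see
  \<open>integrable_inverse_norm_cball\<close>.\<close>

lemma nn_integral_inverse_sqrt_finite:
  "(\<integral>\<^sup>+x. ennreal (indicator {-R..R} x * \<bar>x\<bar> powr (-1/2)) \<partial>lborel) < \<infinity>"
proof (cases "R > 0")
  case True
  have 1: "(\<lambda>x::real. \<bar>x\<bar> powr (-1/2)) integrable_on {0..R}"
    by (rule integrable_eq[OF integrable_on_powr_from_0[of "-1/2" R]]) (use True in auto)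
  then have "(\<lambda>x::real. \<bar>-x\<bar> powr (-1/2)) integrable_on {-R..-0}"
    using Henstock_Kurzweil_Integration.integrable_reflect_real[where f = "\<lambda>x::real. \<bar>x\<bar> powr (-1/2)" and a = 0 and b = R] by simp
  then have "(\<lambda>x::real. \<bar>x\<bar> powr (-1/2)) integrable_on {-R..R}"
    using 1 True by (intro Henstock_Kurzweil_Integration.integrable_combine[where a = "-R" and c = 0 and b = R]) auto
  then obtain I where "((\<lambda>x::real. \<bar>x\<bar> powr (-1/2)) has_integral I) {-R..R}"
    by blast
  then have "((\<lambda>x. indicator {-R..R} x * \<bar>x\<bar> powr (-1/2)) has_integral I) UNIV"
    by (subst (asm) has_integral_restrict_UNIV[symmetric]) (simp add: indicator_def of_bool_def if_distrib[of "\<lambda>y. y * _"] cong: if_cong)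
  then have "(\<integral>\<^sup>+x. ennreal (indicator {-R..R} x * \<bar>x\<bar> powr (-1/2)) \<partial>lborel) = ennreal I"
    by (intro nn_integral_has_integral_lborel) auto
  then show ?thesis by simp
next
  case False
  \<comment> \<open>The interval is now empty or \<open>{0}\<close>, and
    \<open>0 powr (-1/2) = 0\<close>.\<close>
  then have "indicator {-R..R} x * \<bar>x\<bar> powr (-1/2) = 0" for x :: real
    by (auto simp: indicator_def)
  then show ?thesis by (simp only: ennreal_0) simp
qed

text \<open>Since |Re z| |Im z| \<le> |z|^2, the function 1/|z| is at most |Re z|^(-1/2) |Im
  z|^(-1/2), a product of locally integrable functions of one variable. Tonelli's theorem thus
  replaces polar coordinates.\<close>

lemma integrable_inverse_norm_cball:
  "integrable lborel (\<lambda>z::complex. indicator (cball 0 R) z * inverse (norm z))"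
proof (rule integrableI_bounded)
  show "(\<lambda>z::complex. indicator (cball 0 R) z * inverse (norm z)) \<in> borel_measurable lborel"
    by (intro borel_measurable_times borel_measurable_indicator borel_measurable_inverse
        borel_measurable_norm) auto
  let ?g = "\<lambda>x::real. indicator {-R..R} x * \<bar>x\<bar> powr (-1/2)"
  \<comment> \<open>The coordinate axes have to be excluded: there \<open>0 powr (-1/2) = 0\<close>
    makes the majorant vanish.\<close>
  have "AE z::complex in lborel. Re z \<noteq> 0 \<and> Im z \<noteq> 0"
  proof (rule AE_conjI)
    have *: "AE z::complex in lborel. z \<bullet> k \<noteq> 0" if "k \<in> Basis" for k
      using negligible_standard_hyperplane[OF that, of 0]
      by (auto dest: negligible_imp_AE_lborel)
    show "AE z in lborel. Re z \<noteq> 0" using *[of "1::complex"] by (simp add: Basis_complex_def)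
    show "AE z in lborel. Im z \<noteq> 0" using *[of \<i>] by (simp add: Basis_complex_def)
  qed
  then have "AE z::complex in lborel. ennreal (norm (indicator (cball 0 R) z * inverse (norm z)))
    \<le> (\<Prod>b\<in>Basis. ennreal (?g (z \<bullet> b)))"
  proof (rule eventually_mono)
    fix z :: complex assume z: "Re z \<noteq> 0 \<and> Im z \<noteq> 0"
    show "ennreal (norm (indicator (cball 0 R) z * inverse (norm z)))
        \<le> (\<Prod>b\<in>Basis. ennreal (?g (z \<bullet> b)))"
    proof (cases "norm z \<le> R")
      case True
      have "\<bar>Re z\<bar> * \<bar>Im z\<bar> \<le> norm z * norm z"
        by (intro mult_mono abs_Re_le_cmod abs_Im_le_cmod) auto
      then have "sqrt (\<bar>Re z\<bar> * \<bar>Im z\<bar>) \<le> norm z"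
        by (intro real_le_lsqrt) (auto simp: power2_eq_square)
      then have "inverse (norm z) \<le> inverse (sqrt \<bar>Re z\<bar> * sqrt \<bar>Im z\<bar>)"
        using z by (intro le_imp_inverse_le) (auto simp: real_sqrt_mult)
      moreover have "\<bar>Re z\<bar> \<le> R" "\<bar>Im z\<bar> \<le> R"
        using True abs_Re_le_cmod[of z] abs_Im_le_cmod[of z] by linarith+
      ultimately have "indicator (cball 0 R) z * inverse (norm z) \<le> ?g (Re z) * ?g (Im z)"
        using z True by (auto simp: indicator_def powr_minus powr_half_sqrt abs_le_iff)
      then show ?thesis
        by (simp add: Basis_complex_def ennreal_mult'[symmetric] abs_mult)
    qed auto
  qed
  then have "(\<integral>\<^sup>+z. ennreal (norm (indicator (cball 0 R) z * inverse (norm (z::complex)))) \<partial>lborel)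
    \<le> (\<integral>\<^sup>+z. (\<Prod>b\<in>(Basis::complex set). ennreal (?g (z \<bullet> b))) \<partial>lborel)"
    by (rule nn_integral_mono_AE)
  also have "\<dots> = (\<Prod>b\<in>(Basis::complex set). \<integral>\<^sup>+x. ennreal (?g x) \<partial>lborel)"
    by (rule nn_integral_lborel_prod) auto
  also have "\<dots> < \<infinity>"
    using nn_integral_inverse_sqrt_finite[of R] by (auto simp: Basis_complex_def ennreal_mult_less_top)
  finally show "(\<integral>\<^sup>+z. ennreal (norm (indicator (cball 0 R) z * inverse (norm (z::complex)))) \<partial>lborel) < \<infinity>" .
qed

text \<open>Turns the Lipschitz condition on the boundary curve into the bound on its velocity that
  Fubini's theorem needs.\<close>

lemma lipschitz_vector_derivative_bound:
  assumes lip: "L-lipschitz_on X f" and x: "x \<in> interior X"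
    and D: "(f has_vector_derivative D) (at x)"
  shows "norm D \<le> L"
proof (rule tendsto_upperbound[OF tendsto_norm[OF has_vector_derivative_quotient[OF D]]])
  have "\<forall>\<^sub>F h in at 0. x + h \<in> interior X"
  proof -
    have "((\<lambda>h. x + h) \<longlongrightarrow> x + 0) (at 0)" by (intro tendsto_intros)
    then show ?thesis using x by (simp add: topological_tendstoD)
  qed
  then show "\<forall>\<^sub>F h in at 0. norm ((f (x + h) - f x) /\<^sub>R h) \<le> L"
  proof (rule eventually_mono)
    fix h assume h: "x + h \<in> interior X"
    have "dist (f (x + h)) (f x) \<le> L * dist (x + h) x"
      using h x interior_subset by (intro lipschitz_onD[OF lip]) auto
    then show "norm ((f (x + h) - f x) /\<^sub>R h) \<le> L"
      using lipschitz_on_nonneg[OF lip] unfolding norm_scaleR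
      by (cases "h = 0") (auto simp: dist_norm divide_simps mult.commute)
  qed
qed simp

text \<open>The Wirtinger derivative with respect to the conjugate variable; for a real
  differentiable function it vanishes exactly where the Cauchy-Riemann equations hold.\<close>

definition dbar :: "(complex \<Rightarrow> complex) \<Rightarrow> complex \<Rightarrow> complex" where
  "dbar f z = (frechet_derivative f (at z) 1 + \<i> * frechet_derivative f (at z) \<i>) / 2"

lemma dbar_eq:
  assumes "(f has_derivative D) (at z)"
  shows "dbar f z = (D 1 + \<i> * D \<i>) / 2"
  using frechet_derivative_at[OF assms] by (simp add: dbar_def)

lemma dbar_diff_cmult:
  assumes f: "Ck_on 1 UNIV f" and g: "Ck_on 1 UNIV g"
  shows "dbar (\<lambda>z. f z - c * g z) z = dbar f z - c * dbar g z"
proof -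
  have "((\<lambda>z. f z - c * g z) has_derivative (\<lambda>v. frechet_derivative f (at z) v
      - c * frechet_derivative g (at z) v)) (at z)"
    by (intro has_derivative_diff has_derivative_mult_right C1_has_derivative[OF f]
        C1_has_derivative[OF g]) auto
  from dbar_eq[OF this] show ?thesis
    by (simp add: dbar_def diff_divide_distrib add_divide_distrib algebra_simps)
qed

lemma dbar_mult:
  assumes f: "Ck_on 1 UNIV f" and g: "Ck_on 1 UNIV g"
  shows "dbar (\<lambda>z. f z * g z) z = f z * dbar g z + dbar f z * g z"
proof -
  have "((\<lambda>z. f z * g z) has_derivative (\<lambda>v. f z * frechet_derivative g (at z) v
      + frechet_derivative f (at z) v * g z)) (at z)"
    by (intro has_derivative_mult C1_has_derivative[OF f] C1_has_derivative[OF g]) auto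
  from dbar_eq[OF this] show ?thesis
    by (simp add: dbar_def diff_divide_distrib add_divide_distrib algebra_simps)
qed

lemma continuous_on_dbar:
  assumes "Ck_on 1 UNIV f"
  shows "continuous_on UNIV (dbar f)"
  unfolding dbar_def
  by (intro continuous_intros C1_continuous_derivative[OF assms]) auto

lemma dbar_outside_support:
  assumes "\<And>z. norm z > R \<Longrightarrow> f z = 0" and "norm z > R"
  shows "dbar f z = 0"
  using frechet_derivative_outside_support[OF assms] by (simp add: dbar_def)

lemma norm_dbar_le:
  assumes "\<And>z v. norm (frechet_derivative f (at z) v) \<le> M * norm v"
  shows "norm (dbar f z) \<le> M"
proof -
  have "norm (frechet_derivative f (at z) 1 + \<i> * frechet_derivative f (at z) \<i>) \<le> M + M"
    using norm_triangle_mono[OF assms[of z 1] order_trans[OF _ assms[of z \<i>]]]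
    by (simp add: norm_mult)
  then show ?thesis by (simp add: dbar_def norm_divide)
qed

lemma integral_dbar_eq_0:
  assumes f: "Ck_on 1 UNIV f" and supp: "\<And>z. norm z > R \<Longrightarrow> f z = 0"
  shows "(LINT z|lborel. dbar f z) = 0"
proof -
  have "integrable lborel (\<lambda>z. frechet_derivative f (at z) v)" for v
    by (rule integrable_continuous_compact_support[OF C1_continuous_derivative[OF f]])
      (rule frechet_derivative_outside_support[OF supp])
  then show ?thesis
    unfolding dbar_def by (simp add: integral_derivative_eq_0[OF f supp])
qed

text \<open>The Cauchy kernel $1/z$ is approximated by the smooth kernels \<open>cnj z / (\<bar>z\<bar>\<^sup>2 + e)\<close>.\<close>

lemma dbar_regularised_kernel:
  assumes e: "e > 0"
  defines "k \<equiv> \<lambda>z. cnj z * of_real (inverse (z \<bullet> z + e))"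
  shows "Ck_on 1 UNIV k" "dbar k z = of_real (e / (z \<bullet> z + e)\<^sup>2)"
proof -
  have pos: "z \<bullet> z + e > 0" for z :: complex
    using e by (intro add_nonneg_pos) auto
  then have nz: "z \<bullet> z + e \<noteq> 0" for z :: complex by (metis less_irrefl)
  show "Ck_on 1 UNIV k"
    unfolding k_def
    by (intro C1_mult C1_linear[OF bounded_linear_cnj] C1_bounded_linear[OF bounded_linear_of_real]
        C1_inverse C1_add C1_inner C1_linear[OF bounded_linear_ident] C1_const nz)
  define D where "D = z \<bullet> z + e"
  have D: "D > 0" "D = (Re z)\<^sup>2 + (Im z)\<^sup>2 + e"
    using pos by (auto simp: D_def inner_complex_def power2_eq_square)
  have "((\<lambda>z. inverse (z \<bullet> z + e)) has_derivative
      (\<lambda>v. - (inverse D * (2 * (z \<bullet> v)) * inverse D))) (at z)"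
    unfolding D_def by (rule Deriv.has_derivative_inverse[where f = "\<lambda>z. z \<bullet> z + e", OF nz])
      (auto intro!: derivative_eq_intros simp: inner_commute)
  from has_derivative_mult[OF has_derivative_cnj[OF has_derivative_ident]
      has_derivative_of_real[OF this]]
  have "(k has_derivative (\<lambda>v. cnj z * of_real (- (inverse D * (2 * (z \<bullet> v)) * inverse D))
       + cnj v * of_real (inverse D))) (at z)"
    by (simp add: k_def D_def)
  moreover define a where "a = inverse D"
  ultimately have "(k has_derivative (\<lambda>v. cnj z * of_real (- (a * (2 * (z \<bullet> v)) * a))
       + cnj v * of_real a)) (at z)"
    by simp
  from dbar_eq[OF this] have "dbar k z = of_real (a - ((Re z)\<^sup>2 + (Im z)\<^sup>2) * (a * a))"
    by (simp add: complex_eq_iff algebra_simps power2_eq_square)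
  also have "(Re z)\<^sup>2 + (Im z)\<^sup>2 = D - e" using D by simp
  also have "a - (D - e) * (a * a) = e / D\<^sup>2"
    using D(1) by (simp add: a_def field_simps power2_eq_square)
  finally show "dbar k z = of_real (e / (z \<bullet> z + e)\<^sup>2)" by (simp add: D_def)
qed

text \<open>The functions \<open>e / (z \<bullet> z + e)\<^sup>2\<close>, which are
  \<open>dbar\<close> of the regularised kernels, concentrate at the origin with total mass pi as
  \<open>e\<close> tends to 0. The hypothesis \<open>f 0 = 0\<close> kills that mass: by |f z| \<le>
  M |z| the corresponding term is dominated by M/|z|, and it tends to 0 pointwise. What remains is
  the limit of the integrals of \<open>dbar (F n)\<close>, all of which vanish.\<close>

lemma integral_dbar_div_eq_0:
  assumes f: "Ck_on 1 UNIV f" and supp: "\<And>z. norm z > R \<Longrightarrow> f z = 0" and f0: "f 0 = 0"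
  shows "(LINT z|lborel. dbar f z / z) = 0"
proof -
  obtain M where M: "M \<ge> 0" "\<And>z v. norm (frechet_derivative f (at z) v) \<le> M * norm v"
    "\<And>z w. norm (f z - f w) \<le> M * norm (z - w)"
    using C1_compact_support_bounds[OF f supp] by metis
  define k where "k n z = cnj z * of_real (inverse (z \<bullet> z + 1 / real (Suc n)))" for n z
  have k: "Ck_on 1 UNIV (k n)" "dbar (k n) z = of_real ((1 / real (Suc n)) / (z \<bullet> z + 1 / real (Suc n))\<^sup>2)" for n z
    using dbar_regularised_kernel[of "1 / real (Suc n)"] by (simp_all add: k_def[abs_def])
  define F where "F n z = f z * k n z" for n z
  have F: "Ck_on 1 UNIV (F n)" for n
    unfolding F_def by (intro C1_mult f k)
  have dF: "dbar (F n) z = f z * dbar (k n) z + dbar f z * k n z" for n z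
    unfolding F_def by (rule dbar_mult[OF f k(1)])
  have e0: "(\<lambda>n. 1 / real (Suc n)) \<longlonglongrightarrow> 0"
    by (rule LIMSEQ_Suc[OF lim_1_over_n])
  have sup_F: "F n z = 0" if "norm z > R" for n z
    using supp[OF that] by (simp add: F_def)
  have "(\<lambda>n. LINT z|lborel. dbar (F n) z) \<longlonglongrightarrow> (LINT z|lborel. dbar f z / z)"
  \<comment> \<open>Each of the two terms of the product rule contributes M/|z| on the
    support.\<close>
  proof (rule integral_dominated_convergence[where w = "\<lambda>z. 2 * M * (indicator (cball 0 R) z * inverse (norm z))"])
    show "(\<lambda>z. dbar f z / z) \<in> borel_measurable lborel"
      using borel_measurable_continuous_onI[OF continuous_on_dbar[OF f]] by simp
    show "dbar (F n) \<in> borel_measurable lborel" for n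
      using borel_measurable_continuous_onI[OF continuous_on_dbar[OF F]] by simp
    show "integrable lborel (\<lambda>z. 2 * M * (indicator (cball 0 R) z * inverse (norm (z::complex))))"
      by (intro integrable_mult_right integrable_inverse_norm_cball)
    show "AE z in lborel. (\<lambda>n. dbar (F n) z) \<longlonglongrightarrow> dbar f z / z"
    proof (rule AE_I2)
      fix z :: complex
      show "(\<lambda>n. dbar (F n) z) \<longlonglongrightarrow> dbar f z / z"
      proof (cases "z = 0")
        case True
        \<comment> \<open>At the origin both sides are 0: \<open>f 0 = 0\<close>,
          \<open>k n 0 = 0\<close>, and division by 0 gives 0.\<close>
        then show ?thesis using f0 by (simp add: dF k_def)
      next
        case False
        then have zz: "z \<bullet> z \<noteq> 0" by simp
        have den: "(\<lambda>n. z \<bullet> z + 1 / real (Suc n)) \<longlonglongrightarrow> z \<bullet> z"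
          using tendsto_add[OF tendsto_const e0, of "z \<bullet> z"] by simp
        have "(\<lambda>n. (1 / real (Suc n)) / (z \<bullet> z + 1 / real (Suc n))\<^sup>2) \<longlonglongrightarrow> 0 / (z \<bullet> z)\<^sup>2"
          by (intro tendsto_divide tendsto_power den e0) (use zz in simp)
        moreover have "(\<lambda>n. inverse (z \<bullet> z + 1 / real (Suc n))) \<longlonglongrightarrow> inverse (z \<bullet> z)"
          by (intro tendsto_inverse den zz)
        ultimately have "(\<lambda>n. dbar (F n) z) \<longlonglongrightarrow>
            f z * of_real (0 / (z \<bullet> z)\<^sup>2) + dbar f z * (cnj z * of_real (inverse (z \<bullet> z)))"
          unfolding dF k(2) unfolding k_def by (intro tendsto_add tendsto_mult tendsto_const tendsto_of_real)
        moreover have "cnj z * of_real (inverse (z \<bullet> z)) = inverse z"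
          using False complex_norm_square[of z] by (simp add: dot_square_norm field_simps)
        ultimately show ?thesis by (simp add: divide_inverse)
      qed
    qed
    show "AE z in lborel. norm (dbar (F n) z) \<le> 2 * M * (indicator (cball 0 R) z * inverse (norm z))" for n
    proof (rule AE_I2)
      fix z :: complex
      define e where "e = 1 / real (Suc n)"
      have e: "e > 0" by (simp add: e_def)
      have zz: "z \<bullet> z = (norm z)\<^sup>2" by (rule dot_square_norm)
      show "norm (dbar (F n) z) \<le> 2 * M * (indicator (cball 0 R) z * inverse (norm z))"
      proof (cases "norm z \<le> R")
        case True
        show ?thesis
        proof (cases "z = 0")
          case True
          then show ?thesis using f0 M(1) by (simp add: dF k_def)
        next
          case False
          define s where "s = norm z"
          have s: "s > 0" using False by (simp add: s_def)
          have "norm (f z * dbar (k n) z) \<le> (M * s) * (e / (s\<^sup>2 + e)\<^sup>2)"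
            unfolding norm_mult k(2) e_def[symmetric] zz s_def[symmetric] norm_of_real
            using M(1) M(3)[of z 0] f0 e by (intro mult_mono) (auto simp: s_def)
          also have "\<dots> \<le> M * inverse s"
          proof -
            \<comment> \<open>The cross term of the square alone is
              \<open>2 * e * s\<^sup>2\<close>.\<close>
            have "e * s\<^sup>2 \<le> (s\<^sup>2 + e)\<^sup>2"
              using e s by (simp add: power2_sum)
            then have "s * (e / (s\<^sup>2 + e)\<^sup>2) \<le> inverse s"
              using e s by (simp add: divide_simps power2_eq_square mult_ac)
            from mult_left_mono[OF this M(1)] show ?thesis by (simp only: mult.assoc)
          qed
          finally have 1: "norm (f z * dbar (k n) z) \<le> M * inverse s" .
          have "norm (dbar f z * k n z) \<le> M * (s * inverse (s\<^sup>2 + e))"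
            unfolding norm_mult k_def e_def[symmetric] zz s_def[symmetric] norm_of_real
            using norm_dbar_le[OF M(2), of z] e M(1) by (intro mult_mono) (auto simp: s_def norm_mult)
          also have "\<dots> \<le> M * inverse s"
          proof (intro mult_left_mono M(1))
            have "s * s \<le> s\<^sup>2 + e" using e by (simp add: power2_eq_square)
            then show "s * inverse (s\<^sup>2 + e) \<le> inverse s"
              using e s add_pos_pos[of "s\<^sup>2" e] by (simp add: divide_simps)
          qed
          finally have "norm (dbar (F n) z) \<le> M * inverse s + M * inverse s"
            unfolding dF using 1 by (intro norm_triangle_mono) auto
          then show ?thesis using True by (simp add: s_def)
        qed
      next
        case False
        then show ?thesis using dbar_outside_support[of R "F n" z, OF sup_F] by simp
      qed
    qed
  qed
  moreover have "(LINT z|lborel. dbar (F n) z) = 0" for n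
    using integral_dbar_eq_0[OF F sup_F] .
  ultimately show ?thesis by (simp add: LIMSEQ_const_iff)
qed

text \<open>Translating the singularity to the origin moves the support into a ball of radius
  \<open>R + S\<close>. The bound is uniform in \<open>w\<close> because it will be integrated along
  a curve, which stays within some radius \<open>S\<close>.\<close>

lemma
  assumes f: "Ck_on 1 UNIV f" and supp: "\<And>z. norm z > R \<Longrightarrow> f z = 0"
  shows integrable_dbar_cauchy_kernel: "integrable lborel (\<lambda>z. dbar f z / (z - w))"
    and integral_norm_dbar_cauchy_kernel_bound:
      "\<exists>B. \<forall>w. norm w \<le> S \<longrightarrow> (LINT z|lborel. norm (dbar f z / (z - w))) \<le> B"
proof -
  obtain M where M: "M \<ge> 0" "\<And>z v. norm (frechet_derivative f (at z) v) \<le> M * norm v"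
    using C1_compact_support_bounds[OF f supp] by metis
  have [measurable]: "dbar f \<in> borel_measurable borel"
    by (rule borel_measurable_continuous_onI[OF continuous_on_dbar[OF f]])
  have bound: "norm (dbar f (z + w) / z) \<le> M * (indicator (cball 0 (R + S)) z * inverse (norm z))"
    if "norm w \<le> S" for z w S
  proof (cases "norm (z + w) \<le> R")
    case True
    then have "norm z \<le> R + S" using that norm_triangle_ineq4[of "z + w" w] by simp
    then show ?thesis
      using norm_dbar_le[OF M(2), of "z + w"] by (simp add: norm_divide divide_right_mono flip: divide_inverse)
  next
    case False
    then show ?thesis using M(1) dbar_outside_support[of R f "z + w", OF supp] by simp
  qed
  have int: "integrable lborel (\<lambda>z. dbar f (z + w) / z)" for w
    by (rule Bochner_Integration.integrable_bound[OF integrable_mult_right[OF integrable_inverse_norm_cball, of M "R + norm w"]])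
      (use bound[of w "norm w"] M(1) in auto)
  show "integrable lborel (\<lambda>z. dbar f z / (z - w))"
    using integrable_lborel_translation[OF int[of w], of "- w"] by simp
  show "\<exists>B. \<forall>w. norm w \<le> S \<longrightarrow> (LINT z|lborel. norm (dbar f z / (z - w))) \<le> B"
  proof (intro exI allI impI)
    fix w :: complex assume w: "norm w \<le> S"
    have "(LINT z|lborel. norm (dbar f z / (z - w))) = (LINT z|lborel. norm (dbar f (z + w) / z))"
      using integral_lborel_translation[of "\<lambda>z. norm (dbar f z / (z - w))" w] by simp
    also have "\<dots> \<le> (LINT z|lborel. M * (indicator (cball 0 (R + S)) z * inverse (norm (z::complex))))"
      using bound[OF w] by (intro integral_mono integrable_norm int integrable_mult_right integrable_inverse_norm_cball) auto
    finally show "(LINT z|lborel. norm (dbar f z / (z - w)))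
      \<le> (LINT z|lborel. M * (indicator (cball 0 (R + S)) z * inverse (norm (z::complex))))" .
  qed
qed

text \<open>Subtracting \<open>f 0 * c\<close>, with \<open>c\<close> a fixed cutoff equal to 1 at
  0, leaves a function vanishing at 0; so the integral of \<open>dbar f z / z\<close> depends on
  \<open>f\<close> through \<open>f 0\<close> alone, and translation handles the other points. The
  constant is not computed from the cutoff but identified later from one example.\<close>

lemma cauchy_pompeiu_constant:
  obtains C where "\<And>f R w. Ck_on 1 UNIV f \<Longrightarrow> (\<And>z. norm z > R \<Longrightarrow> f z = 0) \<Longrightarrow>
    (LINT z|lborel. dbar f z / (z - w)) = C * f w"
proof -
  obtain b :: "complex \<Rightarrow> real" where b: "Ck_on 1 UNIV b" "\<And>z. z \<in> cball 0 1 \<Longrightarrow> b z = 1"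
    "\<And>z. z \<notin> ball 0 (2 * 1) \<Longrightarrow> b z = 0"
    using C1_bump_ball[of 1 "0::complex"] by auto
  define c where "c z = complex_of_real (b z)" for z
  have c: "Ck_on 1 UNIV c" "c 0 = 1" "\<And>z. norm z > 2 \<Longrightarrow> c z = 0"
    unfolding c_def using b by (auto intro!: C1_bounded_linear[OF bounded_linear_of_real] simp del: Ck_on.simps One_nat_def)
  define C where "C = (LINT z|lborel. dbar c z / z)"
  have 0: "(LINT z|lborel. dbar f z / z) = C * f 0"
    if f: "Ck_on 1 UNIV f" and supp: "\<And>z. norm z > R \<Longrightarrow> f z = 0" for f R
  proof -
    define h where "h z = f z - f 0 * c z" for z
    have "Ck_on 1 UNIV h"
      unfolding h_def by (intro C1_diff C1_mult C1_const f c)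
    then have "(LINT z|lborel. dbar h z / z) = 0"
      by (rule integral_dbar_div_eq_0[where R = "max R 2"]) (auto simp: h_def supp c)
    moreover have "dbar h z / z = dbar f z / z - f 0 * (dbar c z / z)" for z
      unfolding h_def dbar_diff_cmult[OF f c(1)] by (simp add: diff_divide_distrib)
    moreover have "integrable lborel (\<lambda>z. dbar f z / z)" "integrable lborel (\<lambda>z. dbar c z / z)"
      using integrable_dbar_cauchy_kernel[where R = R and w = 0, OF f supp]
        integrable_dbar_cauchy_kernel[where R = 2 and w = 0, OF c(1) c(3)] by simp_all
    ultimately show ?thesis
      by (simp add: C_def mult.commute del: times_divide_eq_right)
  qed
  show thesis
  proof
    fix f R w assume f: "Ck_on 1 UNIV f" and supp: "\<And>z. norm (z::complex) > R \<Longrightarrow> f z = (0::complex)"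
    have g: "Ck_on 1 UNIV (\<lambda>z. f (z + w))"
      by (rule C1_compose[OF f]) (auto intro!: C1_add C1_linear[OF bounded_linear_ident] C1_const simp del: Ck_on.simps One_nat_def)
    have "dbar (\<lambda>z. f (z + w)) z = dbar f (z + w)" for z
    proof -
      have "((\<lambda>z. f (z + w)) has_derivative frechet_derivative f (at (z + w))) (at z)"
        by (rule has_derivative_compose[of "\<lambda>z. z + w" "\<lambda>v. v"])
          (auto intro!: derivative_eq_intros C1_has_derivative[OF f])
      from dbar_eq[OF this] show ?thesis by (simp add: dbar_def)
    qed
    moreover have "(LINT z|lborel. dbar (\<lambda>z. f (z + w)) z / z) = C * f (0 + w)"
    proof (rule 0[OF g])
      fix z :: complex assume "norm z > R + norm w"
      then show "f (z + w) = 0"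
        using norm_diff_ineq[of z w] by (intro supp) linarith
    qed
    moreover have "(\<lambda>z. dbar f z / (z - w)) \<in> borel_measurable borel"
      using borel_measurable_integrable[OF integrable_dbar_cauchy_kernel[OF f supp]] by simp
    ultimately show "(LINT z|lborel. dbar f z / (z - w)) = C * f w"
      using integral_lborel_translation[of "\<lambda>z. dbar f z / (z - w)" w] by simp
  qed
qed

section \<open>Green's theorem\<close>

text \<open>Fubini's theorem asks for the velocity as a bounded Borel function on the whole line. It
  is set to 0 at break points, at the endpoints and outside the unit interval, which changes no
  contour integral.\<close>

lemma valid_path_derivative_lborel:
  fixes \<gamma> :: "real \<Rightarrow> complex"
  assumes \<gamma>: "valid_path \<gamma>" and lip: "L-lipschitz_on {0..1} \<gamma>"
  obtains g where "g \<in> borel_measurable borel" "\<And>t. norm (g t) \<le> L"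
    "\<And>t. t \<notin> {0..1} \<Longrightarrow> g t = 0"
    "\<And>\<phi>. continuous_on (path_image \<gamma>) \<phi> \<Longrightarrow>
      (\<phi> has_contour_integral (LINT t|lborel. g t * \<phi> (\<gamma> t))) \<gamma>"
proof -
  obtain S where S: "finite S" "\<gamma> C1_differentiable_on ({0..1} - S)"
    using \<gamma> by (auto simp: valid_path_def piecewise_C1_differentiable_on_def)
  \<comment> \<open>Dropping the endpoints as well makes \<open>T\<close> open and puts its points
    in the interior of \<open>{0..1}\<close>, where the Lipschitz bound on the derivative
    applies.\<close>
  define T where "T = {0<..<1} - S"
  have T: "open T" "T \<subseteq> {0..1}" unfolding T_def using S(1) by (auto intro: finite_imp_closed)
  have sub: "{0..1} - T \<subseteq> S \<union> {0, 1}" by (auto simp: T_def)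
  have diff: "\<gamma> differentiable (at t)" if "t \<in> T" for t
    using S(2) that by (auto simp: T_def C1_differentiable_on_eq)
  have cont: "continuous_on T (\<lambda>t. vector_derivative \<gamma> (at t))"
    using S(2) by (auto simp: T_def C1_differentiable_on_eq elim: continuous_on_subset)
  define g where "g t = indicator T t *\<^sub>R vector_derivative \<gamma> (at t)" for t
  have g_meas: "g \<in> borel_measurable borel"
    unfolding g_def by (rule borel_measurable_continuous_on_indicator[OF _ cont]) (use T in auto)
  have L: "L \<ge> 0" using lip by (rule lipschitz_on_nonneg)
  have g_bound: "norm (g t) \<le> L" for t
    unfolding g_def
    using lipschitz_vector_derivative_bound[OF lip, of t] diff[of t] L
    by (cases "t \<in> T") (auto simp: T_def vector_derivative_works)
  have g_out: "g t = 0" if "t \<notin> {0..1}" for t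
    using that T by (auto simp: g_def indicator_def)
  show thesis
  proof
    fix \<phi> :: "complex \<Rightarrow> complex" assume \<phi>: "continuous_on (path_image \<gamma>) \<phi>"
    have cont_\<phi>: "continuous_on {0..1} (\<lambda>t. \<phi> (\<gamma> t))"
      using continuous_on_compose2[OF \<phi>, of "{0..1}" \<gamma>] valid_path_imp_path[OF \<gamma>]
      by (auto simp: path_def path_image_def)
    have int: "integrable lborel (\<lambda>t. g t * \<phi> (\<gamma> t))"
    proof (rule Bochner_Integration.integrable_bound)
      show "integrable lborel (\<lambda>t. indicator {0..1} t *\<^sub>R (L * norm (\<phi> (\<gamma> t))))"
        by (rule borel_integrable_compact) (auto intro!: continuous_intros cont_\<phi>)
      have "(\<lambda>t. indicator {0..1} t *\<^sub>R \<phi> (\<gamma> t)) \<in> borel_measurable borel"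
        by (rule borel_measurable_continuous_on_indicator[OF _ cont_\<phi>]) auto
      then have "(\<lambda>t. g t * (indicator {0..1} t *\<^sub>R \<phi> (\<gamma> t))) \<in> borel_measurable borel"
        using g_meas by measurable
      also have "(\<lambda>t. g t * (indicator {0..1} t *\<^sub>R \<phi> (\<gamma> t))) = (\<lambda>t. g t * \<phi> (\<gamma> t))"
        using g_out by (auto simp: indicator_def fun_eq_iff)
      finally show "(\<lambda>t. g t * \<phi> (\<gamma> t)) \<in> borel_measurable lborel" by simp
      show "AE t in lborel. norm (g t * \<phi> (\<gamma> t)) \<le> norm (indicator {0..1} t *\<^sub>R (L * norm (\<phi> (\<gamma> t))))"
      proof (rule AE_I2)
        fix t show "norm (g t * \<phi> (\<gamma> t)) \<le> norm (indicator {0..1} t *\<^sub>R (L * norm (\<phi> (\<gamma> t))))"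
          using g_bound[of t] g_out[of t] L
          by (cases "t \<in> {0..1}") (auto simp: norm_mult abs_mult intro!: mult_right_mono)
      qed
    qed
    have "((\<lambda>t. g t * \<phi> (\<gamma> t)) has_integral (LINT t|lborel. g t * \<phi> (\<gamma> t))) UNIV"
      using has_integral_integral_lborel[OF int] .
    moreover have "(\<lambda>t. if t \<in> {0..1} then g t * \<phi> (\<gamma> t) else 0) = (\<lambda>t. g t * \<phi> (\<gamma> t))"
      using g_out by (auto simp: fun_eq_iff)
    ultimately have "((\<lambda>t. g t * \<phi> (\<gamma> t)) has_integral (LINT t|lborel. g t * \<phi> (\<gamma> t))) {0..1}"
      using has_integral_restrict_UNIV[of "{0..1}" "\<lambda>t. g t * \<phi> (\<gamma> t)"] by simp
    then show "(\<phi> has_contour_integral (LINT t|lborel. g t * \<phi> (\<gamma> t))) \<gamma>"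
      unfolding has_contour_integral
    proof (rule has_integral_spike_finite[rotated 2])
      show "finite (S \<union> {0, 1})" using S by auto
      fix t :: real assume "t \<in> {0..1} - (S \<union> {0, 1})"
      then show "\<phi> (\<gamma> t) * vector_derivative \<gamma> (at t) = g t * \<phi> (\<gamma> t)"
        by (auto simp: g_def T_def)
    qed
  qed (use g_meas g_bound g_out in auto)
qed

text \<open>That the curve is null permits prescribing the winding number off the curve only, and
  exchanging the inside for the closed region.\<close>

lemma negligible_valid_path_image:
  fixes \<gamma> :: "real \<Rightarrow> complex"
  assumes "valid_path \<gamma>"
  shows "negligible (path_image \<gamma>)"
proof -
  obtain S where S: "finite S" "\<gamma> C1_differentiable_on ({0..1} - S)"
    using assms by (auto simp: valid_path_def piecewise_C1_differentiable_on_def)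
  have "negligible (\<gamma> ` ({0..1} - S))"
    by (rule negligible_differentiable_image_lowdim)
      (use S(2) in \<open>auto simp: C1_differentiable_on_eq differentiable_on_def
         intro: differentiable_at_withinI\<close>)
  then have "negligible (\<gamma> ` ({0..1} - S) \<union> \<gamma> ` S)"
    using S(1) by (intro negligible_Un) (auto intro: negligible_finite)
  then show ?thesis
    by (rule negligible_subset) (auto simp: path_image_def)
qed

text \<open>By the Cauchy-Pompeiu formula \<open>f\<close> is a superposition of the functions $w \mapsto 1/(z - w)$, whose
  integrals along \<open>\<gamma>\<close> are winding numbers.\<close>

lemma contour_integral_eq_integral_winding_number:
  assumes \<gamma>: "valid_path \<gamma>" and lip: "L-lipschitz_on {0..1} \<gamma>"
    and f: "Ck_on 1 UNIV f" and supp: "\<And>z. norm z > R \<Longrightarrow> f z = 0"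
    and CP: "\<And>w. (LINT z|lborel. dbar f z / (z - w)) = C * f w"
    and N: "N \<in> borel_measurable borel" "\<And>z. z \<notin> path_image \<gamma> \<Longrightarrow> winding_number \<gamma> z = N z"
  shows "C * contour_integral \<gamma> f = - 2 * pi * \<i> * (LINT z|lborel. N z * dbar f z)"
proof -
  obtain g where g: "g \<in> borel_measurable borel" "\<And>t. norm (g t) \<le> L"
    "\<And>t. t \<notin> {0..1} \<Longrightarrow> g t = 0"
    "\<And>\<phi>. continuous_on (path_image \<gamma>) \<phi> \<Longrightarrow>
      (\<phi> has_contour_integral (LINT t|lborel. g t * \<phi> (\<gamma> t))) \<gamma>"
    using valid_path_derivative_lborel[OF \<gamma> lip] by metis
  have L: "L \<ge> 0" using lip by (rule lipschitz_on_nonneg)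
  have cont: "continuous_on {0..1} \<gamma>" using valid_path_imp_path[OF \<gamma>] by (simp add: path_def)
  \<comment> \<open>A Borel function on the whole line that replaces \<open>\<gamma>\<close>, about
    which nothing is known off the unit interval; \<open>g\<close> vanishes there.\<close>
  define h where "h t = indicator {0..1} t *\<^sub>R \<gamma> t" for t
  have h: "h t = \<gamma> t" if "t \<in> {0..1}" for t using that by (simp add: h_def)
  have [measurable]: "h \<in> borel_measurable borel"
    unfolding h_def by (rule borel_measurable_continuous_on_indicator[OF _ cont]) auto
  have [measurable]: "dbar f \<in> borel_measurable borel"
    by (rule borel_measurable_continuous_onI[OF continuous_on_dbar[OF f]])
  note [measurable] = g(1) N(1)
  obtain S where S: "\<And>t. t \<in> {0..1} \<Longrightarrow> norm (\<gamma> t) \<le> S"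
    using compact_imp_bounded[OF compact_continuous_image[OF cont]] bounded_iff by (metis compact_Icc image_eqI)
  obtain B where B: "\<And>w. norm w \<le> S \<Longrightarrow> (LINT z|lborel. norm (dbar f z / (z - w))) \<le> B"
    using integral_norm_dbar_cauchy_kernel_bound[where R = R and S = S, OF f supp] by auto
  define K where "K t z = g t * (dbar f z / (z - h t))" for t z
  have K_meas: "(\<lambda>(t, z). K t z) \<in> borel_measurable (lborel \<Otimes>\<^sub>M lborel)"
    unfolding K_def by measurable
  have K_int: "integrable lborel (K t)" for t
    unfolding K_def by (intro integrable_mult_right integrable_dbar_cauchy_kernel[where R = R, OF f supp])
  \<comment> \<open>The inner integral over the plane is at most \<open>L * B\<close>, uniformly in
    \<open>t\<close>, because the curve stays within radius \<open>S\<close>.\<close>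
  have int: "integrable (lborel \<Otimes>\<^sub>M lborel) (\<lambda>(t, z). K t z)"
  proof (rule lborel_pair.Fubini_integrable[OF K_meas])
    show "AE t in lborel. integrable lborel (\<lambda>z. case (t, z) of (t, z) \<Rightarrow> K t z)"
      using K_int by simp
    show "integrable lborel (\<lambda>t. LINT z|lborel. norm (case (t, z) of (t, z) \<Rightarrow> K t z))"
    proof (rule Bochner_Integration.integrable_bound)
      show "integrable lborel (\<lambda>t::real. indicator {0..1} t * (L * B))"
        by (intro integrable_mult_left integrable_real_indicator) auto
      show "(\<lambda>t. LINT z|lborel. norm (case (t, z) of (t, z) \<Rightarrow> K t z)) \<in> borel_measurable lborel"
        using K_meas by measurable
      show "AE t in lborel. norm (LINT z|lborel. norm (case (t, z) of (t, z) \<Rightarrow> K t z))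
          \<le> norm (indicator {0..1} t * (L * B))"
      proof (rule AE_I2)
        fix t :: real
        show "norm (LINT z|lborel. norm (case (t, z) of (t, z) \<Rightarrow> K t z))
            \<le> norm (indicator {0..1} t * (L * B))"
        proof (cases "t \<in> {0..1}")
          case True
          have 1: "(LINT z|lborel. norm (K t z)) = norm (g t) * (LINT z|lborel. norm (dbar f z / (z - h t)))"
            unfolding K_def norm_mult by (rule integral_mult_right_zero)
          have "\<dots> \<le> L * B"
            using True by (intro mult_mono g(2) B L) (auto simp: h S intro!: integral_nonneg_AE)
          moreover have "0 \<le> (LINT z|lborel. norm (K t z))" by simp
          ultimately show ?thesis using True 1 by simp
        qed (simp add: K_def g(3))
      qed
    qed
  qed
  have "(LINT z|lborel. LINT t|lborel. K t z) = (LINT t|lborel. LINT z|lborel. K t z)"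
    by (rule lborel_pair.Fubini_integral[OF int])
  also have "\<dots> = (LINT t|lborel. C * (g t * f (\<gamma> t)))"
  proof (rule Bochner_Integration.integral_cong[OF refl])
    fix t show "(LINT z|lborel. K t z) = C * (g t * f (\<gamma> t))"
      unfolding K_def using g(3)[of t] h[of t] CP[of "\<gamma> t"]
      by (cases "t \<in> {0..1}") (auto simp del: times_divide_eq_right)
  qed
  also have "\<dots> = C * contour_integral \<gamma> f"
    using contour_integral_unique[OF g(4)[OF continuous_on_subset[OF C1_continuous[OF f]]]] by simp
  also have "(LINT z|lborel. LINT t|lborel. K t z) = (LINT z|lborel. - 2 * pi * \<i> * (N z * dbar f z))"
  proof (rule integral_cong_AE)
    show "(\<lambda>z. LINT t|lborel. K t z) \<in> borel_measurable lborel"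
      unfolding K_def by measurable
    show "AE z in lborel. (LINT t|lborel. K t z) = - 2 * pi * \<i> * (N z * dbar f z)"
      using negligible_imp_AE_lborel[OF negligible_valid_path_image[OF \<gamma>]]
    proof (rule eventually_mono)
      fix z assume z: "z \<notin> path_image \<gamma>"
      have "(LINT t|lborel. K t z) = (LINT t|lborel. dbar f z * (g t * (1 / (z - \<gamma> t))))"
      proof (rule Bochner_Integration.integral_cong[OF refl])
        fix t show "K t z = dbar f z * (g t * (1 / (z - \<gamma> t)))"
          unfolding K_def using g(3)[of t] h[of t] by (cases "t \<in> {0..1}") auto
      qed
      also have "\<dots> = dbar f z * contour_integral \<gamma> (\<lambda>w. 1 / (z - w))"
      proof -
        have "continuous_on (path_image \<gamma>) (\<lambda>w. 1 / (z - w))"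
          using z by (auto intro!: continuous_intros)
        from contour_integral_unique[OF g(4)[OF this]] show ?thesis
          by (simp only: integral_mult_right_zero)
      qed
      \<comment> \<open>Source of the minus sign: in the Cauchy kernel the plane variable comes
        first, in the winding number the curve variable.\<close>
      also have "contour_integral \<gamma> (\<lambda>w. 1 / (z - w)) = - contour_integral \<gamma> (\<lambda>w. 1 / (w - z))"
        by (subst contour_integral_neg[symmetric]) (simp add: minus_divide_right)
      also have "contour_integral \<gamma> (\<lambda>w. 1 / (w - z)) = 2 * pi * \<i> * N z"
        using winding_number_valid_path[OF \<gamma> z] N(2)[OF z] by simp
      finally show "(LINT t|lborel. K t z) = - 2 * pi * \<i> * (N z * dbar f z)" by simp
    qed
  qed measurable
  also have "\<dots> = - 2 * pi * \<i> * (LINT z|lborel. N z * dbar f z)"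
    by (rule integral_mult_right_zero)
  finally show ?thesis by simp
qed

lemma cauchy_pompeiu:
  assumes f: "Ck_on 1 UNIV f" and supp: "\<And>z. norm z > R \<Longrightarrow> f z = 0"
  shows "(LINT z|lborel. dbar f z / (z - w)) = - complex_of_real pi * f w"
proof -
  obtain C where C: "\<And>f R w. Ck_on 1 UNIV f \<Longrightarrow> (\<And>z. norm z > R \<Longrightarrow> f z = 0) \<Longrightarrow>
    (LINT z|lborel. dbar f z / (z - w)) = C * f w"
    using cauchy_pompeiu_constant by blast
  txt \<open>The constant is read off from \<open>cnj\<close> and the unit circle, where \<open>cnj w = 1 / w\<close>.\<close>
  obtain b :: "complex \<Rightarrow> real" where b: "Ck_on 1 UNIV b" "\<And>z. z \<in> cball 0 1 \<Longrightarrow> b z = 1"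
    "\<And>z. z \<notin> ball 0 (2 * 1) \<Longrightarrow> b z = 0"
    using C1_bump_ball[of 1 "0::complex"] by auto
  define h where "h z = b z *\<^sub>R cnj z" for z
  have h: "Ck_on 1 UNIV h"
    unfolding h_def by (intro C1_scaleR b C1_linear bounded_linear_cnj)
  have supp_h: "h z = 0" if "norm z > 2" for z
    using b(3)[of z] that by (simp add: h_def)
  have dbar_h: "dbar h z = 1" if "z \<in> ball 0 1" for z
  proof -
    have "(h has_derivative cnj) (at z)"
      by (rule has_derivative_transform_within_open[OF bounded_linear_imp_has_derivative[OF bounded_linear_cnj], of "ball 0 1"])
        (use that b(2) in \<open>auto simp: h_def\<close>)
    from dbar_eq[OF this] show ?thesis by simp
  qed
  let ?c = "circlepath (0::complex) 1"
  have lip: "(2 * pi)-lipschitz_on {0..1} ?c"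
  proof (rule bounded_derivative_imp_lipschitz)
    show "(?c has_derivative (\<lambda>t. t *\<^sub>R (2 * of_real pi * \<i> * of_real 1 * exp (2 * of_real pi * \<i> * x)))) (at x within {0..1})" for x
      using has_vector_derivative_circlepath[of 0 1 x "{0..1}"] by (simp add: has_vector_derivative_def)
    show "onorm (\<lambda>t. t *\<^sub>R (2 * of_real pi * \<i> * of_real 1 * exp (2 * of_real pi * \<i> * of_real x))) \<le> 2 * pi" for x :: real
      by (rule onorm_le) (simp add: norm_mult norm_exp_eq_Re)
  qed auto
  \<comment> \<open>The contour formula is stated for an arbitrary constant, so it can be used
    before the constant is known. Here it amounts to C times 2 pi i = - 2 pi i times pi, the last
    factor being the area of the disc.\<close>
  have "C * contour_integral ?c h = - 2 * pi * \<i> * (LINT z|lborel. indicator (ball 0 1) z * dbar h z)"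
  proof (rule contour_integral_eq_integral_winding_number[OF valid_path_circlepath lip h supp_h])
    show "(LINT z|lborel. dbar h z / (z - w)) = C * h w" for w
      by (rule C[OF h supp_h])
    show "winding_number ?c z = indicator (ball 0 1) z" if "z \<notin> path_image ?c" for z
    proof (cases "norm z < 1")
      case True
      then show ?thesis using winding_number_circlepath[of z 0 1] by simp
    next
      case False
      with that have "z \<notin> cball 0 1" by (auto simp: dist_norm)
      then have "winding_number ?c z = 0"
        by (intro winding_number_zero_outside[of _ "cball 0 1"]) auto
      then show ?thesis using False by simp
    qed
    show "indicator (ball 0 1) \<in> borel_measurable borel"
      by (rule borel_measurable_indicator) auto
  qed
  also have "(LINT z|lborel. indicator (ball 0 1) z * dbar h z) = (LINT z|lborel. complex_of_real (indicator (ball (0::complex) 1) z))"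
    by (rule Bochner_Integration.integral_cong) (auto simp: indicator_def dbar_h)
  also have "\<dots> = pi"
    by (subst integral_complex_of_real) (simp add: content_ball eval_unit_ball_vol)
  also have "contour_integral ?c h = contour_integral ?c (\<lambda>w. 1 / (w - 0))"
  proof (rule contour_integral_eq)
    fix w assume "w \<in> path_image ?c"
    then have w: "norm w = 1" by simp
    then have "w \<noteq> 0" by auto
    then show "h w = 1 / (w - 0)"
      using w b(2)[of w] complex_norm_square[of w] by (simp add: h_def eq_divide_eq mult.commute)
  qed
  also have "\<dots> = 2 * pi * \<i>"
    using winding_number_valid_path[of ?c 0] winding_number_circlepath[of 0 0 1] by simp
  finally have "C * (2 * pi * \<i>) = - complex_of_real pi * (2 * pi * \<i>)" by simp
  then have "C = - complex_of_real pi" by (subst (asm) mult_right_cancel) auto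
  then show ?thesis using C[where R = R, OF f supp] by simp
qed

section \<open>Extension by zero and Green's theorem for a Jordan curve\<close>

lemma C1_Un:
  assumes "open V" "open W" "Ck_on 1 V f" "Ck_on 1 W f"
  shows "Ck_on 1 (V \<union> W) f"
  using assms by (auto intro!: continuous_on_open_Un)

text \<open>The function is of class C1 on \<open>V\<close> as a product and on the complement of
  \<open>L\<close> as 0, and these two open sets cover the space.\<close>

lemma C1_extend_by_zero:
  assumes b: "Ck_on 1 UNIV b" and L: "closed L" "L \<subseteq> V" "\<And>z. z \<notin> L \<Longrightarrow> b z = 0"
    and V: "open V" and f: "Ck_on 1 V f"
  shows "Ck_on 1 UNIV (\<lambda>z. if z \<in> V then b z *\<^sub>R f z else 0)" (is "Ck_on 1 UNIV ?g")
proof -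
  have "Ck_on 1 (V \<union> - L) ?g"
  proof (rule C1_Un)
    show "Ck_on 1 V ?g"
      by (rule C1_cong[OF V C1_scaleR[OF C1_subset[OF b] f]]) auto
    show "Ck_on 1 (- L) ?g"
      by (rule C1_cong[OF _ C1_const[of _ 0]]) (use L in auto)
  qed (use L V in auto)
  moreover have "V \<union> - L = UNIV" using L by auto
  ultimately show ?thesis by simp
qed

lemma compact_region:
  assumes "simple_path \<gamma>" "pathfinish \<gamma> = pathstart \<gamma>"
  shows "compact (region \<gamma>)"
proof -
  have c: "compact (path_image \<gamma>)"
    using assms by (simp add: compact_simple_path_image)
  have "region \<gamma> = - outside (path_image \<gamma>)"
    unfolding region_def using union_with_inside by blast
  then have "closed (region \<gamma>)"
    using open_outside[OF compact_imp_closed[OF c]] by (simp add: open_closed)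
  moreover have "bounded (region \<gamma>)"
    unfolding region_def using bounded_inside[OF compact_imp_bounded[OF c]] compact_imp_bounded[OF c] by simp
  ultimately show ?thesis by (simp add: compact_eq_bounded_closed)
qed

text \<open>The pair (A, B) is packed into f = A - i B: the real part of f dz is A dx + B dy, and
  the real part of 2 i \<open>dbar f\<close> is the curl. The imaginary parts express the flux form
  of the theorem and are discarded.\<close>

theorem green_theorem:
  fixes A B :: "complex \<Rightarrow> real"
  assumes \<gamma>: "simple_path \<gamma>" "pathfinish \<gamma> = pathstart \<gamma>" "valid_path \<gamma>" "L-lipschitz_on {0..1} \<gamma>"
    and wind: "\<And>z. z \<in> inside (path_image \<gamma>) \<Longrightarrow> winding_number \<gamma> z = 1"
    and V: "open V" "region \<gamma> \<subseteq> V" and A: "Ck_on 1 V A" and B: "Ck_on 1 V B"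
  shows "((\<lambda>t. A (\<gamma> t) * Re (vector_derivative \<gamma> (at t)) + B (\<gamma> t) * Im (vector_derivative \<gamma> (at t)))
    has_integral integral (region \<gamma>) (\<lambda>u. frechet_derivative B (at u) 1 - frechet_derivative A (at u) \<i>)) {0..1}"
proof -
  obtain b W K where b: "Ck_on 1 UNIV b" "open W" "region \<gamma> \<subseteq> W" "\<And>z. z \<in> W \<Longrightarrow> b z = (1::real)"
    "compact K" "K \<subseteq> V" "\<And>z. z \<notin> K \<Longrightarrow> b z = 0"
    using C1_cutoff[OF compact_region[OF \<gamma>(1,2)] V] by metis
  define F where "F z = complex_of_real (A z) - \<i> * of_real (B z)" for z
  have F: "Ck_on 1 V F"
    unfolding F_def by (intro C1_diff C1_mult C1_const C1_bounded_linear[OF bounded_linear_of_real] A B)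
  define f where "f z = (if z \<in> V then b z *\<^sub>R F z else 0)" for z
  have f: "Ck_on 1 UNIV f"
    unfolding f_def by (rule C1_extend_by_zero[OF b(1) compact_imp_closed[OF b(5)] b(6,7) V(1) F]) auto
  obtain R where R: "\<forall>z\<in>K. norm z \<le> R"
    using compact_imp_bounded[OF b(5)] unfolding bounded_iff ..
  have supp: "f z = 0" if "norm z > R" for z
  proof -
    have "z \<notin> K" using that R by auto
    then show ?thesis using b(7) by (simp add: f_def)
  qed
  have f_region: "f z = F z" if "z \<in> region \<gamma>" for z
    using that V b(3,4) by (auto simp: f_def)
  have dbar_f: "2 * \<i> * dbar f z = of_real (frechet_derivative B (at z) 1 - frechet_derivative A (at z) \<i>)
      + \<i> * of_real (frechet_derivative A (at z) 1 + frechet_derivative B (at z) \<i>)"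
    if z: "z \<in> region \<gamma>" for z
  proof -
    have "(F has_derivative (\<lambda>v. of_real (frechet_derivative A (at z) v)
        - \<i> * of_real (frechet_derivative B (at z) v))) (at z)"
      unfolding F_def using z V
      by (intro has_derivative_diff has_derivative_mult_right has_derivative_of_real
          C1_has_derivative[OF A] C1_has_derivative[OF B]) auto
    \<comment> \<open>The cutoff is 1 on the open set \<open>W\<close>, so \<open>f\<close> and
      \<open>F\<close> agree near \<open>z\<close> and not only at \<open>z\<close>.\<close>
    then have "(f has_derivative (\<lambda>v. of_real (frechet_derivative A (at z) v)
        - \<i> * of_real (frechet_derivative B (at z) v))) (at z)"
      by (rule has_derivative_transform_within_open[where s = "V \<inter> W"])
        (use z V b in \<open>auto simp: f_def\<close>)
    from dbar_eq[OF this] show ?thesis by (simp add: complex_eq_iff)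
  qed
  let ?I = "inside (path_image \<gamma>)"
  have open_I: "open ?I"
    using \<gamma>(1) by (intro open_inside compact_imp_closed) (simp add: compact_simple_path_image)
  have "- complex_of_real pi * contour_integral \<gamma> f = - 2 * pi * \<i> * (LINT z|lborel. indicator ?I z * dbar f z)"
  proof (rule contour_integral_eq_integral_winding_number[OF \<gamma>(3,4) f supp cauchy_pompeiu[OF f supp]])
    show "indicator ?I \<in> borel_measurable borel"
      by (rule borel_measurable_indicator) (use open_I in auto)
    show "winding_number \<gamma> z = indicator ?I z" if "z \<notin> path_image \<gamma>" for z
    proof (cases "z \<in> ?I")
      case False
      then have "z \<in> outside (path_image \<gamma>)"
        using that union_with_outside by (auto simp: outside_inside)
      then show ?thesis
        using False \<gamma> by (simp add: winding_number_zero_in_outside simple_path_imp_path)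
    qed (simp add: wind)
  qed auto
  then have ci: "contour_integral \<gamma> f = 2 * \<i> * (LINT z|lborel. indicator ?I z * dbar f z)"
    by (simp add: field_simps)
  have int: "integrable lborel (\<lambda>z. indicator ?I z *\<^sub>R dbar f z)"
    using integrable_continuous_compact_support[OF continuous_on_dbar[OF f], of R]
      dbar_outside_support[of R f] supp open_I by (intro integrable_mult_indicator) auto
  have "((\<lambda>z. indicator ?I z *\<^sub>R dbar f z) has_integral (LINT z|lborel. indicator ?I z *\<^sub>R dbar f z)) UNIV"
    by (rule has_integral_integral_lborel[OF int])
  moreover have "(\<lambda>z. indicator ?I z *\<^sub>R dbar f z) = (\<lambda>z. if z \<in> ?I then dbar f z else 0)"
    by auto
  moreover have "(LINT z|lborel. indicator ?I z *\<^sub>R dbar f z) = (LINT z|lborel. indicator ?I z * dbar f z)"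
    by (rule Bochner_Integration.integral_cong) (auto simp: indicator_def)
  ultimately have "(dbar f has_integral (LINT z|lborel. indicator ?I z * dbar f z)) ?I"
    by (simp add: has_integral_restrict_UNIV)
  \<comment> \<open>The winding number yields an integral over the open inside; adding the null
    curve gives the closed region.\<close>
  then have "(dbar f has_integral (LINT z|lborel. indicator ?I z * dbar f z)) (region \<gamma>)"
    by (subst has_integral_spike_set_eq[of "region \<gamma>" ?I])
      (auto intro: negligible_subset[OF negligible_valid_path_image[OF \<gamma>(3)]] simp: region_def)
  from has_integral_linear[OF has_integral_mult_right[OF this, of "2 * \<i>"] bounded_linear_Re]
  have "((\<lambda>z. Re (2 * \<i> * dbar f z)) has_integral Re (contour_integral \<gamma> f)) (region \<gamma>)"
    by (simp add: o_def ci)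
  then have "((\<lambda>u. frechet_derivative B (at u) 1 - frechet_derivative A (at u) \<i>)
      has_integral Re (contour_integral \<gamma> f)) (region \<gamma>)"
    by (rule has_integral_eq[rotated]) (simp only: dbar_f, simp)
  then have eq: "integral (region \<gamma>) (\<lambda>u. frechet_derivative B (at u) 1 - frechet_derivative A (at u) \<i>)
      = Re (contour_integral \<gamma> f)"
    by (rule integral_unique)
  have "continuous_on (path_image \<gamma>) f"
    by (rule continuous_on_subset[OF C1_continuous[OF f]]) auto
  then have "f contour_integrable_on \<gamma>"
    unfolding contour_integrable_on_def by (blast intro: valid_path_derivative_lborel[OF \<gamma>(3,4)])
  then have "((\<lambda>t. f (\<gamma> t) * vector_derivative \<gamma> (at t)) has_integral contour_integral \<gamma> f) {0..1}"
    using has_contour_integral_integral has_contour_integral by blast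
  from has_integral_linear[OF this bounded_linear_Re]
  have "((\<lambda>t. Re (f (\<gamma> t) * vector_derivative \<gamma> (at t))) has_integral Re (contour_integral \<gamma> f)) {0..1}"
    by (simp add: o_def)
  then show ?thesis
    unfolding eq
  proof (rule has_integral_eq[rotated])
    fix t :: real assume "t \<in> {0..1}"
    then have "f (\<gamma> t) = F (\<gamma> t)" by (intro f_region) (auto simp: region_def path_image_def)
    then show "Re (f (\<gamma> t) * vector_derivative \<gamma> (at t))
      = A (\<gamma> t) * Re (vector_derivative \<gamma> (at t)) + B (\<gamma> t) * Im (vector_derivative \<gamma> (at t))"
      by (simp add: F_def)
  qed
qed

section \<open>Quaternions\<close>

lemma qmult_bilinear: "bilinear (\<star>)"
  unfolding bilinear_def
  by (auto intro!: linearI simp: qmult_def prod_eq_iff inner_simps algebra_simps cross_add_left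
      cross_add_right cross_mult_left cross_mult_right)

lemma bounded_bilinear_qmult: "bounded_bilinear (\<star>)"
  using qmult_bilinear bilinear_conv_bounded_bilinear by blast

lemma qmult_assoc: "f \<star> g \<star> h = f \<star> (g \<star> h)"
  by (simp add: qmult_def prod_eq_iff vec_eq_iff forall_3 inner_vec_def sum_3 cross3_def algebra_simps)

lemma norm_quat_squared: "(norm (q :: quat))\<^sup>2 = (fst q)\<^sup>2 + snd q \<bullet> snd q"
  by (simp add: norm_prod_def dot_square_norm)

text \<open>In components this is Euler's four-square identity.\<close>

lemma norm_qmult: "norm (f \<star> g) = norm f * norm g"
proof -
  have "(norm (f \<star> g))\<^sup>2 = (norm f)\<^sup>2 * (norm g)\<^sup>2"
    unfolding norm_quat_squared
    by (simp add: qmult_def inner_vec_def sum_3 cross3_def power2_eq_square algebra_simps)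
  then have "(norm (f \<star> g))\<^sup>2 = (norm f * norm g)\<^sup>2" by (simp add: power_mult_distrib)
  then show ?thesis by (simp add: power2_eq_iff_nonneg)
qed

lemma fst_qmult_pure_scalar: "fst ((0, a) \<star> (0, n) \<star> (s, 0)) = - s * (a \<bullet> n)"
  by (simp add: qmult_def)

lemma bounded_linear_fst_qmult_right: "bounded_linear (\<lambda>q. fst (q \<star> g))"
  using bounded_linear_compose[OF bounded_linear_fst
      bounded_bilinear.bounded_linear_left[OF bounded_bilinear_qmult, of g]] .

lemma bounded_linear_pure: "bounded_linear (\<lambda>v. (0, v) :: quat)"
  by (intro bounded_linear_Pair bounded_linear_zero bounded_linear_ident)

section \<open>Stokes' theorem and primitives on a patch\<close>

lemma surface_patchE:
  assumes "surface_patch \<Phi> \<gamma>"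
  obtains U L where "simple_path \<gamma>" "pathfinish \<gamma> = pathstart \<gamma>" "valid_path \<gamma>"
    "L-lipschitz_on {0..1} \<gamma>" "\<And>z. z \<in> inside (path_image \<gamma>) \<Longrightarrow> winding_number \<gamma> z = 1"
    "open U" "region \<gamma> \<subseteq> U" "smooth_on U \<Phi>" "inj_on \<Phi> (region \<gamma>)"
    "\<And>u. u \<in> U \<Longrightarrow> cross3 (tangent1 \<Phi> u) (tangent2 \<Phi> u) \<noteq> 0"
  using assms unfolding surface_patch_def by (metis inj_on_subset)

lemma smooth_on_C1:
  assumes "smooth_on U f"
  shows "Ck_on 1 U f"
  using assms unfolding smooth_on_def by blast

lemma smooth_on_C1_derivative:
  assumes "smooth_on U f"
  shows "Ck_on 1 U (\<lambda>x. frechet_derivative f (at x) v)"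
proof -
  have "Ck_on (Suc 1) U f" using assms unfolding smooth_on_def by blast
  then show ?thesis unfolding Ck_on.simps(2)[of 1] by blast
qed

lemma C1_tangent:
  assumes "smooth_on U \<Phi>"
  shows "Ck_on 1 U (tangent1 \<Phi>)" "Ck_on 1 U (tangent2 \<Phi>)"
  using smooth_on_C1_derivative[OF assms] unfolding tangent1_def tangent2_def by blast+

lemma C1_normal_vector:
  assumes "smooth_on U \<Phi>"
  shows "Ck_on 1 U (\<lambda>u. cross3 (tangent1 \<Phi> u) (tangent2 \<Phi> u))"
  using bilinear_cross bilinear_conv_bounded_bilinear
  by (intro C1_bounded_bilinear[of cross3] C1_tangent assms) blast

lemma normal_parametrized:
  assumes "surface_patch \<Phi> \<gamma>" "u \<in> region \<gamma>"
  shows "normal \<Phi> \<gamma> (\<Phi> u) = sgn (cross3 (tangent1 \<Phi> u) (tangent2 \<Phi> u))"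
  using assms by (auto elim!: surface_patchE simp: normal_def Let_def)

text \<open>The density cancels the normalization. This matters because \<open>normal\<close> is
  meaningful on the patch only, whereas the cross product of the tangents is of class C1 on an open
  neighbourhood of the region.\<close>

lemma area_density_scaleR_normal:
  assumes "surface_patch \<Phi> \<gamma>" "u \<in> region \<gamma>"
  shows "area_density \<Phi> u *\<^sub>R normal \<Phi> \<gamma> (\<Phi> u) = cross3 (tangent1 \<Phi> u) (tangent2 \<Phi> u)"
  unfolding normal_parametrized[OF assms] area_density_def
  by (simp add: sgn_div_norm flip: divide_inverse)

lemma area_form_parametrized:
  assumes "surface_patch \<Phi> \<gamma>" "u \<in> region \<gamma>"
  shows "area_form \<Phi> \<gamma> (\<Phi> u) (tangent1 \<Phi> u) (tangent2 \<Phi> u) = area_density \<Phi> u"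
  unfolding area_form_def normal_parametrized[OF assms] area_density_def
  by (simp add: sgn_div_norm dot_square_norm power2_eq_square field_simps)

text \<open>Real forms suffice: the quaternion-valued form is multiplied by its coefficient, and the
  scalar part taken, before Stokes' theorem is applied.\<close>

lemma boundary_integral_eq_integral_exterior_derivative:
  fixes \<omega> :: "real ^ 3 \<Rightarrow> real ^ 3 \<Rightarrow> real"
  assumes patch: "surface_patch \<Phi> \<gamma>" and ext: "is_exterior_derivative \<Phi> \<gamma> \<omega> \<tau>"
  shows "boundary_integral \<Phi> \<gamma> \<omega> =
    integral (region \<gamma>) (\<lambda>u. \<tau> (\<Phi> u) (tangent1 \<Phi> u) (tangent2 \<Phi> u))"
proof -
  obtain U L where U: "simple_path \<gamma>" "pathfinish \<gamma> = pathstart \<gamma>" "valid_path \<gamma>"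
    "L-lipschitz_on {0..1} \<gamma>" "\<And>z. z \<in> inside (path_image \<gamma>) \<Longrightarrow> winding_number \<gamma> z = 1"
    "open U" "region \<gamma> \<subseteq> U" "smooth_on U \<Phi>"
    using surface_patchE[OF patch] by metis
  obtain V A B where V: "open V" "region \<gamma> \<subseteq> V" "Ck_on 1 V A" "Ck_on 1 V B"
    and AB: "\<And>u. u \<in> region \<gamma> \<Longrightarrow> \<omega> (\<Phi> u) (tangent1 \<Phi> u) = A u"
      "\<And>u. u \<in> region \<gamma> \<Longrightarrow> \<omega> (\<Phi> u) (tangent2 \<Phi> u) = B u"
      "\<And>u. u \<in> region \<gamma> \<Longrightarrow> \<tau> (\<Phi> u) (tangent1 \<Phi> u) (tangent2 \<Phi> u) =
        frechet_derivative B (at u) 1 - frechet_derivative A (at u) \<i>"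
    and lin: "\<And>r. r \<in> patch \<Phi> \<gamma> \<Longrightarrow> linear (\<omega> r)"
    using ext unfolding is_exterior_derivative_def by metis
  obtain S where S: "finite S" "\<gamma> C1_differentiable_on ({0..1} - S)"
    using U(3) by (auto simp: valid_path_def piecewise_C1_differentiable_on_def)
  \<comment> \<open>The chain rule for the composed curve holds away from the break points, a finite
    set that does not affect the integral.\<close>
  have eq: "\<omega> (\<Phi> (\<gamma> t)) (vector_derivative (\<Phi> \<circ> \<gamma>) (at t within {0..1})) =
      A (\<gamma> t) * Re (vector_derivative \<gamma> (at t)) + B (\<gamma> t) * Im (vector_derivative \<gamma> (at t))"
    if t: "t \<in> {0..1} - S" for t
  proof -
    define w where "w = vector_derivative \<gamma> (at t)"
    have u: "\<gamma> t \<in> region \<gamma>" using t by (auto simp: region_def path_image_def)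
    have "(\<gamma> has_vector_derivative w) (at t within {0..1})"
      unfolding w_def using S(2) t
      by (auto simp: C1_differentiable_on_eq vector_derivative_works intro: has_vector_derivative_at_within)
    moreover have D: "(\<Phi> has_derivative frechet_derivative \<Phi> (at (\<gamma> t))) (at (\<gamma> t))"
      using u U(7) by (intro C1_has_derivative[OF smooth_on_C1[OF U(8)]]) auto
    ultimately have "(\<Phi> \<circ> \<gamma> has_vector_derivative frechet_derivative \<Phi> (at (\<gamma> t)) w) (at t within {0..1})"
      using vector_derivative_diff_chain_within[of \<gamma> w t "{0..1}" \<Phi>] has_derivative_at_withinI by blast
    then have "vector_derivative (\<Phi> \<circ> \<gamma>) (at t within {0..1}) = frechet_derivative \<Phi> (at (\<gamma> t)) w"
      using t by (intro vector_derivative_within_cbox[of 0 1, simplified]) auto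
    also have "w = Re w *\<^sub>R 1 + Im w *\<^sub>R \<i>" by (simp add: complex_eq_iff)
    also have "frechet_derivative \<Phi> (at (\<gamma> t)) \<dots> = Re w *\<^sub>R tangent1 \<Phi> (\<gamma> t) + Im w *\<^sub>R tangent2 \<Phi> (\<gamma> t)"
      using has_derivative_linear[OF D] by (simp only: linear_add linear_scale tangent1_def tangent2_def)
    finally show ?thesis
      using lin[of "\<Phi> (\<gamma> t)"] u AB(1,2)[OF u]
      by (simp add: patch_def linear_add linear_scale w_def mult.commute del: o_apply)
  qed
  have "((\<lambda>t. \<omega> (\<Phi> (\<gamma> t)) (vector_derivative (\<Phi> \<circ> \<gamma>) (at t within {0..1}))) has_integral
      integral (region \<gamma>) (\<lambda>u. frechet_derivative B (at u) 1 - frechet_derivative A (at u) \<i>)) {0..1}"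
    by (rule has_integral_spike_finite[OF S(1) _ green_theorem[OF U(1-5) V]]) (use eq in auto)
  then have "boundary_integral \<Phi> \<gamma> \<omega> =
      integral (region \<gamma>) (\<lambda>u. frechet_derivative B (at u) 1 - frechet_derivative A (at u) \<i>)"
    unfolding boundary_integral_def by (rule integral_unique)
  also have "\<dots> = integral (region \<gamma>) (\<lambda>u. \<tau> (\<Phi> u) (tangent1 \<Phi> u) (tangent2 \<Phi> u))"
    by (rule integral_cong) (simp add: AB(3))
  finally show ?thesis .
qed

text \<open>The exterior derivative commutes with linear maps of the values. The case of interest
  has \<open>h\<close> multiplication by \<open>d l m\<close> and \<open>k\<close> the scalar part
  of right multiplication by \<open>g l m\<close>.\<close>

lemma is_exterior_derivative_combination:
  assumes "is_exterior_derivative \<Phi> \<gamma> \<psi> \<tau>1" "is_exterior_derivative \<Phi> \<gamma> \<beta> \<tau>2"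
    and h: "bounded_linear h" and k: "bounded_linear k"
  shows "is_exterior_derivative \<Phi> \<gamma> (\<lambda>r v. h (\<psi> r v) - k (\<beta> r v))
    (\<lambda>r v w. h (\<tau>1 r v w) - k (\<tau>2 r v w))"
proof -
  obtain V1 A1 B1 where prem1: "open V1" "region \<gamma> \<subseteq> V1" "Ck_on 1 V1 A1" "Ck_on 1 V1 B1"
    "\<forall>r \<in> patch \<Phi> \<gamma>. linear (\<psi> r)"
    "\<forall>u \<in> region \<gamma>. \<psi> (\<Phi> u) (tangent1 \<Phi> u) = A1 u \<and> \<psi> (\<Phi> u) (tangent2 \<Phi> u) = B1 u \<and>
      \<tau>1 (\<Phi> u) (tangent1 \<Phi> u) (tangent2 \<Phi> u) =
        frechet_derivative B1 (at u) 1 - frechet_derivative A1 (at u) \<i>"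
    using assms(1) unfolding is_exterior_derivative_def by blast
  obtain V2 A2 B2 where prem2: "open V2" "region \<gamma> \<subseteq> V2" "Ck_on 1 V2 A2" "Ck_on 1 V2 B2"
    "\<forall>r \<in> patch \<Phi> \<gamma>. linear (\<beta> r)"
    "\<forall>u \<in> region \<gamma>. \<beta> (\<Phi> u) (tangent1 \<Phi> u) = A2 u \<and> \<beta> (\<Phi> u) (tangent2 \<Phi> u) = B2 u \<and>
      \<tau>2 (\<Phi> u) (tangent1 \<Phi> u) (tangent2 \<Phi> u) =
        frechet_derivative B2 (at u) 1 - frechet_derivative A2 (at u) \<i>"
    using assms(2) unfolding is_exterior_derivative_def by blast
  have hk: "linear h" "linear k" using h k by (auto intro: bounded_linear.linear)
  let ?V = "V1 \<inter> V2" and ?c = "\<lambda>f g u. h (f u) - k (g u)"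
  have C1: "Ck_on 1 ?V (?c f g)" if "Ck_on 1 V1 f" "Ck_on 1 V2 g" for f g
    by (intro C1_diff C1_bounded_linear[OF h] C1_bounded_linear[OF k]
        C1_subset[OF that(1)] C1_subset[OF that(2)]) auto
  have D: "frechet_derivative (?c f g) (at u) v =
      h (frechet_derivative f (at u) v) - k (frechet_derivative g (at u) v)"
    if "Ck_on 1 V1 f" "Ck_on 1 V2 g" "u \<in> region \<gamma>" for f g u v
  proof -
    have "(?c f g has_derivative (\<lambda>v. h (frechet_derivative f (at u) v)
        - k (frechet_derivative g (at u) v))) (at u)"
      using that prem1 prem2 by (intro has_derivative_diff bounded_linear.has_derivative[OF h]
          bounded_linear.has_derivative[OF k] C1_has_derivative[OF that(1)] C1_has_derivative[OF that(2)]) auto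
    from frechet_derivative_at[OF this, symmetric] show ?thesis by simp
  qed
  show ?thesis
    unfolding is_exterior_derivative_def
  proof (intro conjI ballI, goal_cases)
    case (1 r)
    then show ?case
      using prem1(5) prem2(5) hk
      by (intro linear_compose_sub linear_compose[unfolded o_def, OF _ hk(1)]
          linear_compose[unfolded o_def, OF _ hk(2)]) auto
  next
    case 2
    show ?case
      by (rule exI[of _ ?V], rule exI[of _ "?c A1 A2"], rule exI[of _ "?c B1 B2"])
        (use prem1 prem2 C1 D hk in \<open>auto simp: linear_diff simp del: Ck_on.simps One_nat_def\<close>)
  qed
qed

text \<open>Integrating over a window of fixed length \<open>M\<close> instead of a half line keeps
  the integral proper. The price is a second boundary term, which disappears once the shift by
  \<open>M\<close> leaves the support.\<close>

lemma antiderivative_along_real_axis: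
  fixes f :: "complex \<Rightarrow> 'b::euclidean_space"
  assumes f: "Ck_on 1 UNIV f" and "0 \<le> M"
  defines "F \<equiv> \<lambda>u. integral {0..M} (\<lambda>s. f (u - of_real s))"
  shows "Ck_on 1 UNIV F" "frechet_derivative F (at u) 1 = f u - f (u - of_real M)"
proof -
  \<comment> \<open>Differentiation under the integral by \<open>leibniz_rule\<close> wants a
    derivative that is continuous as a bounded linear map, hence the passage from directional
    derivatives to \<open>Blinfun\<close>.\<close>
  define f' where "f' u = Blinfun (frechet_derivative f (at u))" for u
  have D: "(f has_derivative frechet_derivative f (at u)) (at u)" for u
    by (rule C1_has_derivative[OF f]) simp
  have f': "blinfun_apply (f' u) = frechet_derivative f (at u)" for u
    unfolding f'_def by (rule bounded_linear_Blinfun_apply[OF has_derivative_bounded_linear[OF D]])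
  have cont_f': "continuous_on UNIV f'"
    by (rule continuous_on_blinfun_componentwise) (simp add: f' C1_continuous_derivative[OF f])
  have cont: "continuous_on (UNIV \<times> cbox 0 M) (\<lambda>(u, s). f' (u - of_real s))"
    unfolding split_beta by (intro continuous_on_compose2[OF cont_f'] continuous_intros) auto
  have F': "(F has_derivative integral (cbox 0 M) (\<lambda>s. f' (u - of_real s))) (at u within UNIV)" for u
    unfolding F_def cbox_interval[symmetric]
  proof (rule leibniz_rule[OF _ _ cont])
    show "((\<lambda>u. f (u - of_real s)) has_derivative f' (u - of_real s)) (at u within UNIV)" for u and s :: real
      unfolding f' by (rule has_derivative_compose[of "\<lambda>u. u - of_real s" "\<lambda>v. v"])
        (auto intro!: derivative_eq_intros D)
    show "(\<lambda>s. f (u - of_real s)) integrable_on cbox 0 M" for u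
      by (intro integrable_continuous continuous_on_compose2[OF C1_continuous[OF f]] continuous_intros) auto
  qed auto
  have "continuous_on UNIV (\<lambda>u. integral (cbox 0 M) (\<lambda>s. f' (u - of_real s)))"
    by (rule integral_continuous_on_param) (use cont in \<open>simp add: split_beta\<close>)
  then show "Ck_on 1 UNIV F"
    using F' by (intro C1I[where f' = "\<lambda>u. blinfun_apply (integral (cbox 0 M) (\<lambda>s. f' (u - of_real s)))"]
        continuous_intros) auto
  have int: "(\<lambda>s. f' (u - of_real s)) integrable_on cbox 0 M"
    by (intro integrable_continuous continuous_on_compose2[OF cont_f'] continuous_intros) auto
  have "frechet_derivative F (at u) 1 = integral (cbox 0 M) (\<lambda>s. f' (u - of_real s)) 1"
    using frechet_derivative_at[OF F'[of u]] by simp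
  also have "\<dots> = integral {0..M} (\<lambda>s. frechet_derivative f (at (u - of_real s)) 1)"
    by (subst blinfun_apply_integral[OF int]) (simp add: f')
  also have "\<dots> = - f (u - of_real M) - (- f (u - of_real 0))"
  proof (rule integral_unique[OF fundamental_theorem_of_calculus[OF \<open>0 \<le> M\<close>]])
    fix s :: real
    have "((\<lambda>s. f (u - of_real s)) has_derivative
        (\<lambda>v. frechet_derivative f (at (u - of_real s)) (- of_real v))) (at s within {0..M})"
      by (rule has_derivative_compose[OF _ D]) (auto intro!: derivative_eq_intros)
    then have "((\<lambda>s. - f (u - of_real s)) has_derivative
        (\<lambda>v. - frechet_derivative f (at (u - of_real s)) (- of_real v))) (at s within {0..M})"
      by (rule has_derivative_minus)
    moreover have "- frechet_derivative f (at (u - of_real s)) (- of_real v) =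
        v *\<^sub>R frechet_derivative f (at (u - of_real s)) 1" for v
      using linear_scale[OF has_derivative_linear[OF D], of "u - of_real s" "- v" 1]
      by (simp add: of_real_def)
    ultimately show "((\<lambda>s. - f (u - of_real s)) has_vector_derivative
        frechet_derivative f (at (u - of_real s)) 1) (at s within {0..M})"
      by (simp add: has_vector_derivative_def)
  qed
  finally show "frechet_derivative F (at u) 1 = f u - f (u - of_real M)" by simp
qed

lemma partial_primitive_exists:
  fixes f :: "complex \<Rightarrow> 'b::euclidean_space"
  assumes K: "compact K" and V: "open V" "K \<subseteq> V" and f: "Ck_on 1 V f"
  obtains F where "Ck_on 1 UNIV F" "\<And>u. u \<in> K \<Longrightarrow> frechet_derivative F (at u) 1 = f u"
proof -
  obtain b W L where b: "Ck_on 1 UNIV b" "open W" "K \<subseteq> W" "\<And>z. z \<in> W \<Longrightarrow> b z = (1::real)"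
    "compact L" "L \<subseteq> V" "\<And>z. z \<notin> L \<Longrightarrow> b z = 0"
    using C1_cutoff[OF K V] by metis
  define g where "g z = (if z \<in> V then b z *\<^sub>R f z else 0)" for z
  have g: "Ck_on 1 UNIV g"
    unfolding g_def by (rule C1_extend_by_zero[OF b(1) compact_imp_closed[OF b(5)] b(6,7) V(1) f]) auto
  obtain R where R: "\<forall>z\<in>K \<union> L. norm z \<le> R"
    using compact_imp_bounded[OF compact_Un[OF K b(5)]] unfolding bounded_iff ..
  \<comment> \<open>For u in \<open>K\<close> the point u - M has norm at least M - |R| = |R| + 1,
    so it lies outside the support \<open>L\<close> of the cutoff.\<close>
  define M where "M = 2 * \<bar>R\<bar> + 1"
  show thesis
  proof
    show "Ck_on 1 UNIV (\<lambda>u. integral {0..M} (\<lambda>s. g (u - of_real s)))"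
      by (rule antiderivative_along_real_axis[OF g]) (simp add: M_def)
    fix u assume u: "u \<in> K"
    have "norm (u - of_real M) \<ge> norm (complex_of_real M) - norm u"
      using norm_triangle_ineq3[of "complex_of_real M" u] by (simp add: norm_minus_commute)
    moreover have "norm (complex_of_real M) = M" by (simp add: M_def del: of_real_add)
    moreover have "norm u \<le> \<bar>R\<bar>" using R u by (auto intro: order_trans)
    ultimately have "norm (u - of_real M) > R" by (simp add: M_def)
    then have "u - of_real M \<notin> L" using R by (metis UnI2 not_le)
    then have "g (u - of_real M) = 0" using b(7) by (simp add: g_def)
    moreover have "g u = f u" using u b(3,4) V(2) by (auto simp: g_def)
    ultimately show "frechet_derivative (\<lambda>u. integral {0..M} (\<lambda>s. g (u - of_real s))) (at u) 1 = f u"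
      by (subst antiderivative_along_real_axis[OF g]) (auto simp: M_def)
  qed
qed

lemma exterior_primitive_exists:
  fixes \<tau> :: "real ^ 3 \<Rightarrow> real ^ 3 \<Rightarrow> real ^ 3 \<Rightarrow> 'b::euclidean_space"
  assumes patch: "surface_patch \<Phi> \<gamma>" and V: "open V" "region \<gamma> \<subseteq> V" and f: "Ck_on 1 V f"
    and \<tau>: "\<And>u. u \<in> region \<gamma> \<Longrightarrow> \<tau> (\<Phi> u) (tangent1 \<Phi> u) (tangent2 \<Phi> u) = f u"
  shows "\<exists>\<omega>. is_exterior_derivative \<Phi> \<gamma> \<omega> \<tau>"
proof -
  obtain U where U: "simple_path \<gamma>" "pathfinish \<gamma> = pathstart \<gamma>" "region \<gamma> \<subseteq> U" "inj_on \<Phi> (region \<gamma>)"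
    "\<And>u. u \<in> U \<Longrightarrow> cross3 (tangent1 \<Phi> u) (tangent2 \<Phi> u) \<noteq> 0"
    using surface_patchE[OF patch] by metis
  obtain B where B: "Ck_on 1 UNIV B" "\<And>u. u \<in> region \<gamma> \<Longrightarrow> frechet_derivative B (at u) 1 = f u"
    using partial_primitive_exists[OF compact_region[OF U(1,2)] V f] by metis
  define n where "n u = cross3 (tangent1 \<Phi> u) (tangent2 \<Phi> u)" for u
  \<comment> \<open>This is \<open>B du\<^sub>2\<close> written for ambient vectors: if v = a t1 + b
    t2 with t1, t2 the tangents at \<open>u\<close>, then \<open>cross3\<close> of t1 and v is b
    times \<open>n u\<close>, so the quotient recovers the coordinate b.\<close>
  define \<eta> where "\<eta> u v = ((cross3 (tangent1 \<Phi> u) v \<bullet> n u) / (n u \<bullet> n u)) *\<^sub>R B u" for u v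
  define \<omega> where "\<omega> r = \<eta> (inv_into (region \<gamma>) \<Phi> r)" for r
  have \<omega>: "\<omega> (\<Phi> u) = \<eta> u" if "u \<in> region \<gamma>" for u
    using that U(4) by (simp add: \<omega>_def)
  have lin: "linear (\<eta> u)" for u
    unfolding \<eta>_def
    by (rule linearI) (simp_all add: cross_add_right cross_mult_right inner_simps add_divide_distrib scaleR_add_left)
  have t2: "\<eta> u (tangent2 \<Phi> u) = B u" if "u \<in> region \<gamma>" for u
    using U(3,5) that by (auto simp: \<eta>_def n_def)
  have t1: "\<eta> u (tangent1 \<Phi> u) = 0" for u
    by (simp add: \<eta>_def)
  have "is_exterior_derivative \<Phi> \<gamma> \<omega> \<tau>"
    unfolding is_exterior_derivative_def
  proof
    show "\<forall>r\<in>patch \<Phi> \<gamma>. linear (\<omega> r)" using lin by (simp add: \<omega>_def)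
    show "\<exists>V A B. open V \<and> region \<gamma> \<subseteq> V \<and> Ck_on 1 V A \<and> Ck_on 1 V B \<and>
        (\<forall>u \<in> region \<gamma>. \<omega> (\<Phi> u) (tangent1 \<Phi> u) = A u \<and> \<omega> (\<Phi> u) (tangent2 \<Phi> u) = B u \<and>
           \<tau> (\<Phi> u) (tangent1 \<Phi> u) (tangent2 \<Phi> u) =
             frechet_derivative B (at u) 1 - frechet_derivative A (at u) \<i>)"
      by (rule exI[of _ UNIV], rule exI[of _ "\<lambda>_. 0"], rule exI[of _ B])
        (use B \<tau> \<omega> t1 t2 C1_const[of UNIV 0] in \<open>auto simp: frechet_derivative_const simp del: Ck_on.simps One_nat_def\<close>)
  qed
  then show ?thesis by blast
qed

section \<open>Harmonic polynomials and the Green's function\<close>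

lemma real_polynomial_function_component: "real_polynomial_function (\<lambda>r :: real ^ 'n. r $ i)"
  by (rule real_polynomial_function.intros(1)) (rule bounded_linear_vec_nth)

lemma real_polynomial_function_H: "real_polynomial_function (H l m)"
proof -
  note comp = real_polynomial_function_component
  \<comment> \<open>The radius enters \<open>Pi_poly\<close> in even powers only, so the square root
    disappears.\<close>
  have norm_pow: "norm r ^ (2 * k) = (\<Sum>i\<in>UNIV. r $ i * r $ i) ^ k" for r :: "real ^ 3" and k
    by (simp add: power_mult dot_square_norm[symmetric] inner_vec_def)
  \<comment> \<open>Each part of a power depends on both parts of the preceding power, hence the
    joint induction; s = 1 and s = -1 give the two conjugate bases in \<open>B_poly\<close>.\<close>
  have pow: "real_polynomial_function (\<lambda>r :: real ^ 3. Re ((of_real (r $ 2) + \<i> * of_real (s * r $ 3)) ^ k)) \<and>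
      real_polynomial_function (\<lambda>r :: real ^ 3. Im ((of_real (r $ 2) + \<i> * of_real (s * r $ 3)) ^ k))" for k s
  proof (induction k)
    case 0
    then show ?case by (auto intro: real_polynomial_function.intros)
  next
    case (Suc k)
    then show ?case
      by (auto intro!: comp real_polynomial_function.intros(2-4) real_polynomial_function_diff)
  qed
  \<comment> \<open>Dividing by 2 i and taking the real part leaves half the imaginary part.\<close>
  have "B_poly m y z = (Im ((of_real y + \<i> * of_real (1 * z)) ^ m)
      + (- 1) * Im ((of_real y + \<i> * of_real (- 1 * z)) ^ m)) * (1 / 2)" for y z
    by (simp add: B_poly_def Re_divide Im_divide field_simps)
  then have B: "real_polynomial_function (\<lambda>r :: real ^ 3. B_poly m (r $ 2) (r $ 3))"
    by (simp only:) (intro real_polynomial_function.intros(2-4) conjunct2[OF pow])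
  have "real_polynomial_function (\<lambda>r :: real ^ 3. Pi_poly l m (r $ 1) (norm r))"
    unfolding Pi_poly_def norm_pow
    by (intro real_polynomial_function_sum real_polynomial_function.intros(2-4)
        real_polynomial_function_power comp) auto
  then have "real_polynomial_function (\<lambda>r. H l m r)"
    unfolding H_def by (intro real_polynomial_function.intros(2-4) B)
  then show ?thesis .
qed

lemma C1_H: "Ck_on 1 V (H l m)"
  by (rule C1_real_polynomial_function[OF real_polynomial_function_H])

lemma C1_grad_H: "Ck_on 1 V (grad (H l m))"
proof (rule C1_vector)
  show "Ck_on 1 V (\<lambda>r. grad (H l m) r $ i)" for i
    using real_polynomial_function_derivative[OF real_polynomial_function_H]
    by (simp only: grad_def vec_lambda_beta) (intro C1_real_polynomial_function, blast)
qed

section \<open>The Green's function away from the target point\<close>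

lemma C1_ident: "Ck_on 1 V (\<lambda>x. x)"
  by (rule C1_linear[OF bounded_linear_ident])

lemma C1_norm_difference: "Ck_on 1 (- {r'}) (\<lambda>r :: 'a::euclidean_space. norm (r' - r))"
  by (intro C1_norm C1_diff C1_const C1_ident) auto

lemma C1_green: "Ck_on 1 (- {r'}) (green r')"
proof -
  have "Ck_on 1 (- {r'}) (\<lambda>r. inverse (4 * pi * norm (r' - r)))"
    by (intro C1_inverse C1_mult C1_const C1_norm_difference) auto
  then show ?thesis by (simp only: green_def[abs_def] inverse_eq_divide)
qed

lemma grad_green:
  assumes "r \<noteq> r'"
  shows "grad (green r') r = inverse (4 * pi * norm (r' - r) ^ 3) *\<^sub>R (r' - r)"
proof -
  define N where "N = norm (r' - r)"
  have N: "N > 0" using assms by (simp add: N_def)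
  have "((\<lambda>r. norm (r' - r)) has_derivative (\<lambda>v. sgn (r' - r) \<bullet> (- v))) (at r)"
  proof -
    have "((\<lambda>r. r' - r) has_derivative (\<lambda>v. - v)) (at r)"
      by (auto intro!: derivative_eq_intros)
    from has_derivative_compose[OF this has_derivative_norm] show ?thesis
      using assms by (simp add: inner_commute)
  qed
  from has_derivative_mult_right[OF this, of "4 * pi"]
  have "((\<lambda>r. 4 * pi * norm (r' - r)) has_derivative (\<lambda>v. 4 * pi * (sgn (r' - r) \<bullet> (- v)))) (at r)" .
  from Deriv.has_derivative_inverse[OF _ this]
  have "(green r' has_derivative (\<lambda>v. - (inverse (4 * pi * N) * (4 * pi * (sgn (r' - r) \<bullet> (- v))) *
      inverse (4 * pi * N)))) (at r)"
    using N by (simp add: N_def green_def[abs_def] inverse_eq_divide)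
  then have "frechet_derivative (green r') (at r) = (\<lambda>v. - (inverse (4 * pi * N) *
      (4 * pi * (sgn (r' - r) \<bullet> (- v))) * inverse (4 * pi * N)))"
    by (rule frechet_derivative_at[symmetric])
  then show ?thesis
    using N by (simp add: grad_def vec_eq_iff sgn_div_norm inner_axis N_def[symmetric] power3_eq_cube field_simps)
qed

text \<open>The explicit gradient spares a second differentiation: it is built from operations
  already known to preserve class C1.\<close>

lemma C1_grad_green: "Ck_on 1 (- {r'}) (grad (green r'))"
proof (rule C1_cong)
  show "Ck_on 1 (- {r'}) (\<lambda>r. inverse (4 * pi * norm (r' - r) ^ 3) *\<^sub>R (r' - r))"
    by (intro C1_scaleR C1_inverse C1_mult C1_power C1_norm_difference C1_diff C1_const C1_ident) auto
qed (auto simp: grad_green)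

section \<open>Surface integrals\<close>

text \<open>The density is merely integrable on the patch, so its product with the kernel is
  controlled through the kernel, which is bounded and measurable as a continuous function on a
  compact set.\<close>

lemma absolutely_integrable_mult_continuous:
  fixes f :: "'a::euclidean_space \<Rightarrow> real" and g :: "'a \<Rightarrow> 'b::euclidean_space"
  assumes "compact S" "continuous_on S f" "g absolutely_integrable_on S"
  shows "(\<lambda>u. f u *\<^sub>R g u) absolutely_integrable_on S"
proof (rule absolutely_integrable_bounded_measurable_product[where h = "(*\<^sub>R)", OF _ _ _ _ assms(3)])
  show "bilinear ((*\<^sub>R) :: real \<Rightarrow> 'b \<Rightarrow> 'b)"
    using bounded_bilinear_scaleR bilinear_conv_bounded_bilinear by blast
  show S: "S \<in> sets lebesgue" using assms(1) by (simp add: compact_imp_closed)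
  show "f \<in> borel_measurable (lebesgue_on S)"
    by (rule continuous_imp_measurable_on_sets_lebesgue[OF assms(2) S])
  show "bounded (f ` S)"
    by (rule compact_imp_bounded[OF compact_continuous_image[OF assms(2,1)]])
qed

lemma absolutely_integrable_continuous_compact:
  fixes f :: "'a::euclidean_space \<Rightarrow> 'b::euclidean_space"
  assumes "compact S" "continuous_on S f"
  shows "f absolutely_integrable_on S"
proof -
  have "integrable lborel (\<lambda>x. indicator S x *\<^sub>R f x)"
    using borel_integrable_compact[OF assms] by (simp add: indicator_scaleR_eq_if)
  then show ?thesis
    unfolding set_integrable_def
    by (subst integrable_completion) (auto dest: borel_measurable_integrable)
qed

lemma continuous_on_area_density_normal:
  assumes "surface_patch \<Phi> \<gamma>"
  shows "continuous_on (region \<gamma>) (area_density \<Phi>)"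
    and "continuous_on (region \<gamma>) (\<lambda>u. normal \<Phi> \<gamma> (\<Phi> u))"
proof -
  obtain U where U: "region \<gamma> \<subseteq> U" "smooth_on U \<Phi>"
    "\<And>u. u \<in> U \<Longrightarrow> cross3 (tangent1 \<Phi> u) (tangent2 \<Phi> u) \<noteq> 0"
    using surface_patchE[OF assms] by metis
  have n: "continuous_on (region \<gamma>) (\<lambda>u. cross3 (tangent1 \<Phi> u) (tangent2 \<Phi> u))"
    by (rule continuous_on_subset[OF C1_continuous[OF C1_normal_vector[OF U(2)]] U(1)])
  then show "continuous_on (region \<gamma>) (area_density \<Phi>)"
    unfolding area_density_def by (intro continuous_intros)
  have "continuous_on (region \<gamma>) (\<lambda>u. sgn (cross3 (tangent1 \<Phi> u) (tangent2 \<Phi> u)))"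
    unfolding sgn_div_norm using U(1,3) by (intro continuous_intros n) auto
  then show "continuous_on (region \<gamma>) (\<lambda>u. normal \<Phi> \<gamma> (\<Phi> u))"
    by (simp add: normal_parametrized[OF assms] cong: continuous_on_cong)
qed

lemma compact_region_surface_patch: "surface_patch \<Phi> \<gamma> \<Longrightarrow> compact (region \<gamma>)"
  by (auto elim!: surface_patchE intro: compact_region)

lemma surface_integrable_continuous:
  assumes "surface_patch \<Phi> \<gamma>" "continuous_on (region \<gamma>) (\<lambda>u. f (\<Phi> u))"
  shows "surface_integrable \<Phi> \<gamma> f"
  unfolding surface_integrable_def
  by (intro absolutely_integrable_continuous_compact compact_region_surface_patch[OF assms(1)]
      continuous_on_scaleR continuous_on_area_density_normal(1)[OF assms(1)] assms)

lemma surface_integrable_mult_continuous: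
  fixes f g :: "real ^ 3 \<Rightarrow> real"
  assumes "surface_patch \<Phi> \<gamma>" "continuous_on (region \<gamma>) (\<lambda>u. f (\<Phi> u))" "surface_integrable \<Phi> \<gamma> g"
  shows "surface_integrable \<Phi> \<gamma> (\<lambda>r. f r * g r)"
  using absolutely_integrable_mult_continuous[OF compact_region_surface_patch[OF assms(1)] assms(2)
      assms(3)[unfolded surface_integrable_def]]
  by (simp add: surface_integrable_def mult.left_commute)

lemma surface_integrable_add:
  "surface_integrable \<Phi> \<gamma> f \<Longrightarrow> surface_integrable \<Phi> \<gamma> g \<Longrightarrow> surface_integrable \<Phi> \<gamma> (\<lambda>r. f r + g r)"
  unfolding surface_integrable_def scaleR_add_right by (rule set_integral_add)

lemma surface_integral_add:
  assumes "surface_integrable \<Phi> \<gamma> f" "surface_integrable \<Phi> \<gamma> g"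
  shows "surface_integral \<Phi> \<gamma> (\<lambda>r. f r + g r) = surface_integral \<Phi> \<gamma> f + surface_integral \<Phi> \<gamma> g"
  using assms unfolding surface_integral_def surface_integrable_def scaleR_add_right
  by (intro integral_add set_lebesgue_integral_eq_integral(1))

lemma surface_integrable_sum:
  assumes "\<And>i. i \<in> I \<Longrightarrow> surface_integrable \<Phi> \<gamma> (f i)"
  shows "surface_integrable \<Phi> \<gamma> (\<lambda>r. \<Sum>i\<in>I. f i r)"
  using assms
proof (induction I rule: infinite_finite_induct)
  case (insert i I)
  then show ?case by (simp add: surface_integrable_add)
qed (simp_all add: surface_integrable_def)

lemma surface_integral_sum:
  assumes "\<And>i. i \<in> I \<Longrightarrow> surface_integrable \<Phi> \<gamma> (f i)"
  shows "surface_integral \<Phi> \<gamma> (\<lambda>r. \<Sum>i\<in>I. f i r) = (\<Sum>i\<in>I. surface_integral \<Phi> \<gamma> (f i))"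
  using assms
proof (induction I rule: infinite_finite_induct)
  case (insert i I)
  then show ?case by (simp add: surface_integral_add surface_integrable_sum)
qed (simp_all add: surface_integral_def)

lemma surface_integral_bounded_linear:
  assumes "bounded_linear h" "surface_integrable \<Phi> \<gamma> f"
  shows "surface_integral \<Phi> \<gamma> (\<lambda>r. h (f r)) = h (surface_integral \<Phi> \<gamma> f)"
proof -
  have "(\<lambda>u. area_density \<Phi> u *\<^sub>R f (\<Phi> u)) integrable_on region \<gamma>"
    using assms(2) unfolding surface_integrable_def by (rule set_lebesgue_integral_eq_integral(1))
  from integral_linear[OF this assms(1)] show ?thesis
    using bounded_linear.linear[OF assms(1)] by (simp add: surface_integral_def o_def linear_scale)
qed

lemma surface_integral_cong:
  assumes "\<And>r. r \<in> patch \<Phi> \<gamma> \<Longrightarrow> f r = g r"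
  shows "surface_integral \<Phi> \<gamma> f = surface_integral \<Phi> \<gamma> g"
  unfolding surface_integral_def using assms by (intro integral_cong) (simp add: patch_def)

lemma norm_surface_integral_le:
  assumes "surface_integrable \<Phi> \<gamma> f" "surface_integrable \<Phi> \<gamma> g"
    and "\<And>r. r \<in> patch \<Phi> \<gamma> \<Longrightarrow> norm (f r) \<le> g r"
  shows "norm (surface_integral \<Phi> \<gamma> f) \<le> surface_integral \<Phi> \<gamma> g"
  unfolding surface_integral_def
proof (rule integral_norm_bound_integral)
  show "(\<lambda>u. area_density \<Phi> u *\<^sub>R f (\<Phi> u)) integrable_on region \<gamma>"
    "(\<lambda>u. area_density \<Phi> u *\<^sub>R g (\<Phi> u)) integrable_on region \<gamma>"
    using assms(1,2) unfolding surface_integrable_def by (blast intro: set_lebesgue_integral_eq_integral(1))+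
  show "norm (area_density \<Phi> u *\<^sub>R f (\<Phi> u)) \<le> area_density \<Phi> u *\<^sub>R g (\<Phi> u)"
    if "u \<in> region \<gamma>" for u
    using that assms(3)[of "\<Phi> u"] by (simp add: patch_def area_density_def mult_left_mono)
qed

section \<open>Reduction to boundary integrals\<close>

text \<open>The sign \<approx> is given content in two ways: an exact identity whose two remainders
  are layer potentials of the replacement errors, and the bound that results from uniform errors.
  Existence of the primitives keeps the second part from being vacuous; it covers all primitives
  because Stokes' theorem sees only their exterior derivatives.\<close>

theorem theorem3p12:
  fixes \<Phi> :: "complex \<Rightarrow> real ^ 3" and \<gamma> :: "real \<Rightarrow> complex"
    and p :: nat and rc :: "nat \<Rightarrow> nat \<Rightarrow> real ^ 3"
    and \<sigma> :: "real ^ 3 \<Rightarrow> real" and r' :: "real ^ 3"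
    and d :: "nat \<Rightarrow> nat \<Rightarrow> real" and g :: "nat \<Rightarrow> nat \<Rightarrow> quat"
  assumes patch: "surface_patch \<Phi> \<gamma>" and contr: "contractible (patch \<Phi> \<gamma>)"
    and p: "p \<ge> 1"
    and pts: "\<And>i j. i + j \<le> p - 1 \<Longrightarrow> rc i j \<in> patch \<Phi> \<gamma>"
    and card_pts: "card {rc i j | i j. i + j \<le> p - 1} = p * (p + 1) div 2"
    and target: "r' \<notin> patch \<Phi> \<gamma>"
    and density: "surface_integrable \<Phi> \<gamma> \<sigma>"
    and d_system: "\<And>i j. i + j \<le> p - 1 \<Longrightarrow>
          (\<Sum>l = 1..p. \<Sum>m = 1..l. (grad (H l m) (rc i j) \<bullet> normal \<Phi> \<gamma> (rc i j)) * d l m)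
            = \<sigma> (rc i j)"
    and g_system: "\<And>i j. i + j \<le> p - 1 \<Longrightarrow>
          (\<Sum>l = 1..p. \<Sum>m = 1..l. (0, grad (H l m) (rc i j)) \<star> g l m) = (rho p d (rc i j), 0)"
  shows "(\<forall>l m. 1 \<le> m \<and> m \<le> l \<and> l \<le> p \<longrightarrow>
            (\<exists>\<psi>. is_exterior_derivative \<Phi> \<gamma> \<psi> (chi_form \<Phi> \<gamma> r' l m)) \<and>
            (\<exists>\<beta>. is_exterior_derivative \<Phi> \<gamma> \<beta> (alpha_form \<Phi> \<gamma> r' l m)))
       \<and> (\<forall>\<psi> \<beta>.
            (\<forall>l m. 1 \<le> m \<and> m \<le> l \<and> l \<le> p \<longrightarrow>
               is_exterior_derivative \<Phi> \<gamma> (\<psi> l m) (chi_form \<Phi> \<gamma> r' l m) \<and>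
               is_exterior_derivative \<Phi> \<gamma> (\<beta> l m) (alpha_form \<Phi> \<gamma> r' l m)) \<longrightarrow>
            single_layer \<Phi> \<gamma> \<sigma> r'
              = one_form_sum \<Phi> \<gamma> p \<psi> d \<beta> g
                + single_layer \<Phi> \<gamma> (\<lambda>r. \<sigma> r - sigma_approx \<Phi> \<gamma> p d r) r'
                - fst (quat_layer \<Phi> \<gamma> (\<lambda>r. (rho p d r, 0) - rho_approx p g r) r')
          \<and> (\<forall>\<epsilon>\<^sub>1 \<epsilon>\<^sub>2.
               (\<forall>r \<in> patch \<Phi> \<gamma>.
                  \<bar>\<sigma> r - sigma_approx \<Phi> \<gamma> p d r\<bar> \<le> \<epsilon>\<^sub>1 \<and>
                  norm ((rho p d r, 0) - rho_approx p g r) \<le> \<epsilon>\<^sub>2) \<longrightarrow>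
               \<bar>single_layer \<Phi> \<gamma> \<sigma> r' - one_form_sum \<Phi> \<gamma> p \<psi> d \<beta> g\<bar>
                 \<le> \<epsilon>\<^sub>1 * surface_integral \<Phi> \<gamma> (green r')
                   + \<epsilon>\<^sub>2 * surface_integral \<Phi> \<gamma> (\<lambda>r. norm (grad (green r') r))))"
proof -
  obtain U where U: "open U" "region \<gamma> \<subseteq> U" "smooth_on U \<Phi>"
    using surface_patchE[OF patch] by metis
  \<comment> \<open>Removing the preimage of the target keeps the kernel of class C1; the region
    stays inside because the target lies off the patch.\<close>
  define V where "V = U \<inter> \<Phi> -` (- {r'})"
  have \<Phi>: "Ck_on 1 V \<Phi>"
    by (rule C1_subset[OF smooth_on_C1[OF U(3)]]) (auto simp: V_def)
  have V: "open V" "region \<gamma> \<subseteq> V"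
  proof -
    show "open V"
      unfolding V_def by (rule continuous_open_preimage[OF C1_continuous[OF smooth_on_C1[OF U(3)]] U(1)]) auto
    show "region \<gamma> \<subseteq> V" using U(2) target by (auto simp: V_def patch_def)
  qed
  have G: "Ck_on 1 V (\<lambda>u. green r' (\<Phi> u))" and dG: "Ck_on 1 V (\<lambda>u. grad (green r') (\<Phi> u))"
    by (rule C1_compose[OF C1_green \<Phi>], force simp: V_def)
      (rule C1_compose[OF C1_grad_green \<Phi>], force simp: V_def)
  have Hl: "Ck_on 1 V (\<lambda>u. H l m (\<Phi> u))" and dH: "Ck_on 1 V (\<lambda>u. grad (H l m) (\<Phi> u))" for l m
    by (rule C1_compose[OF C1_H \<Phi> subset_UNIV]) (rule C1_compose[OF C1_grad_H \<Phi> subset_UNIV])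
  have n: "Ck_on 1 V (\<lambda>u. cross3 (tangent1 \<Phi> u) (tangent2 \<Phi> u))"
    by (rule C1_subset[OF C1_normal_vector[OF U(3)]]) (auto simp: V_def)
  let ?\<nu> = "normal \<Phi> \<gamma>" and ?G = "green r'" and ?dG = "grad (green r')"
  define q where "q r = (0, ?dG r) \<star> (0, ?\<nu> r)" for r

  have \<chi>: "chi_form \<Phi> \<gamma> r' l m (\<Phi> u) (tangent1 \<Phi> u) (tangent2 \<Phi> u) = area_density \<Phi> u *
      ((?G (\<Phi> u) *\<^sub>R grad (H l m) (\<Phi> u) - H l m (\<Phi> u) *\<^sub>R ?dG (\<Phi> u)) \<bullet> ?\<nu> (\<Phi> u))"
    and \<alpha>: "alpha_form \<Phi> \<gamma> r' l m (\<Phi> u) (tangent1 \<Phi> u) (tangent2 \<Phi> u) =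
      area_density \<Phi> u *\<^sub>R (q (\<Phi> u) \<star> (0, grad (H l m) (\<Phi> u)))" if "u \<in> region \<gamma>" for u l m
    using that area_form_parametrized[OF patch that] by (simp_all add: chi_form_def alpha_form_def q_def)

  have ex_\<psi>: "\<exists>\<psi>. is_exterior_derivative \<Phi> \<gamma> \<psi> (chi_form \<Phi> \<gamma> r' l m)" for l m
  proof (rule exterior_primitive_exists[OF patch V])
    show "Ck_on 1 V (\<lambda>u. (?G (\<Phi> u) *\<^sub>R grad (H l m) (\<Phi> u) - H l m (\<Phi> u) *\<^sub>R ?dG (\<Phi> u))
        \<bullet> cross3 (tangent1 \<Phi> u) (tangent2 \<Phi> u))"
      by (intro C1_inner C1_diff C1_scaleR G dG Hl dH n)
    show "chi_form \<Phi> \<gamma> r' l m (\<Phi> u) (tangent1 \<Phi> u) (tangent2 \<Phi> u) =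
        (?G (\<Phi> u) *\<^sub>R grad (H l m) (\<Phi> u) - H l m (\<Phi> u) *\<^sub>R ?dG (\<Phi> u))
        \<bullet> cross3 (tangent1 \<Phi> u) (tangent2 \<Phi> u)" if "u \<in> region \<gamma>" for u
      unfolding \<chi>[OF that] area_density_scaleR_normal[OF patch that, symmetric] by simp
  qed
  have ex_\<beta>: "\<exists>\<beta>. is_exterior_derivative \<Phi> \<gamma> \<beta> (alpha_form \<Phi> \<gamma> r' l m)" for l m
  proof (rule exterior_primitive_exists[OF patch V])
    show "Ck_on 1 V (\<lambda>u. (0, ?dG (\<Phi> u)) \<star> (0, cross3 (tangent1 \<Phi> u) (tangent2 \<Phi> u))
        \<star> (0, grad (H l m) (\<Phi> u)))"
      by (intro C1_bounded_bilinear[OF bounded_bilinear_qmult] C1_bounded_linear[OF bounded_linear_pure] dG dH n)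
    show "alpha_form \<Phi> \<gamma> r' l m (\<Phi> u) (tangent1 \<Phi> u) (tangent2 \<Phi> u) =
        (0, ?dG (\<Phi> u)) \<star> (0, cross3 (tangent1 \<Phi> u) (tangent2 \<Phi> u)) \<star> (0, grad (H l m) (\<Phi> u))"
      if "u \<in> region \<gamma>" for u
    proof -
      have "(0, cross3 (tangent1 \<Phi> u) (tangent2 \<Phi> u)) = area_density \<Phi> u *\<^sub>R (0 :: real, ?\<nu> (\<Phi> u))"
        by (simp add: area_density_scaleR_normal[OF patch that])
      then show ?thesis
        unfolding \<alpha>[OF that] q_def
        by (simp only: bounded_bilinear.scaleR_left[OF bounded_bilinear_qmult]
            bounded_bilinear.scaleR_right[OF bounded_bilinear_qmult])
    qed
  qed

  have cont: "continuous_on (region \<gamma>) (\<lambda>u. ?G (\<Phi> u))" "continuous_on (region \<gamma>) (\<lambda>u. ?dG (\<Phi> u))"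
    "continuous_on (region \<gamma>) (\<lambda>u. H l m (\<Phi> u))" "continuous_on (region \<gamma>) (\<lambda>u. grad (H l m) (\<Phi> u))"
    "continuous_on (region \<gamma>) (\<lambda>u. ?\<nu> (\<Phi> u))" for l m
    using continuous_on_area_density_normal(2)[OF patch]
    by (auto intro: continuous_on_subset[OF C1_continuous V(2)] G dG Hl dH simp del: Ck_on.simps One_nat_def)
  have cont_q: "continuous_on (region \<gamma>) (\<lambda>u. q (\<Phi> u))"
    unfolding q_def by (intro bounded_bilinear.continuous_on[OF bounded_bilinear_qmult] continuous_intros cont)
  have cont_\<sigma>: "continuous_on (region \<gamma>) (\<lambda>u. sigma_approx \<Phi> \<gamma> p d (\<Phi> u))"
    unfolding sigma_approx_def by (intro continuous_intros cont)
  have cont_\<rho>: "continuous_on (region \<gamma>) (\<lambda>u. (rho p d (\<Phi> u), 0) - rho_approx p g (\<Phi> u))"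
    unfolding rho_def rho_approx_def
    by (intro bounded_bilinear.continuous_on[OF bounded_bilinear_qmult] continuous_intros cont)
  let ?\<delta>\<sigma> = "\<lambda>r. \<sigma> r - sigma_approx \<Phi> \<gamma> p d r"
    and ?\<delta>\<rho> = "\<lambda>r. (rho p d r, 0) - rho_approx p g r"
  note cont_qmult = bounded_bilinear.continuous_on[OF bounded_bilinear_qmult]
  have int_G\<sigma>: "surface_integrable \<Phi> \<gamma> (\<lambda>r. ?G r * sigma_approx \<Phi> \<gamma> p d r)"
    by (rule surface_integrable_continuous[OF patch]) (intro continuous_intros cont cont_\<sigma>)
  have int_q\<rho>: "surface_integrable \<Phi> \<gamma> (\<lambda>r. q r \<star> ?\<delta>\<rho> r)"
    by (rule surface_integrable_continuous[OF patch]) (intro cont_qmult cont_q cont_\<rho>)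
  have int_\<delta>\<sigma>: "surface_integrable \<Phi> \<gamma> ?\<delta>\<sigma>"
    using surface_integrable_add[OF density surface_integrable_continuous[OF patch continuous_on_minus[OF cont_\<sigma>]]]
    by simp
  have int_G\<delta>\<sigma>: "surface_integrable \<Phi> \<gamma> (\<lambda>r. ?G r * ?\<delta>\<sigma> r)"
    by (rule surface_integrable_mult_continuous[OF patch cont(1) int_\<delta>\<sigma>])
  have quat: "quat_layer \<Phi> \<gamma> ?\<delta>\<rho> r' = surface_integral \<Phi> \<gamma> (\<lambda>r. q r \<star> ?\<delta>\<rho> r)"
    by (simp add: quat_layer_def q_def)

  have identity: "single_layer \<Phi> \<gamma> \<sigma> r' = one_form_sum \<Phi> \<gamma> p \<psi> d \<beta> g
      + single_layer \<Phi> \<gamma> ?\<delta>\<sigma> r' - fst (quat_layer \<Phi> \<gamma> ?\<delta>\<rho> r')"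
    if prim: "\<forall>l m. 1 \<le> m \<and> m \<le> l \<and> l \<le> p \<longrightarrow>
       is_exterior_derivative \<Phi> \<gamma> (\<psi> l m) (chi_form \<Phi> \<gamma> r' l m) \<and>
       is_exterior_derivative \<Phi> \<gamma> (\<beta> l m) (alpha_form \<Phi> \<gamma> r' l m)" for \<psi> \<beta>
  proof -
    \<comment> \<open>The density, with respect to area, of the 2-form whose primitive is integrated
      over the boundary.\<close>
    define s where "s l m r = ((?G r *\<^sub>R grad (H l m) r - H l m r *\<^sub>R ?dG r) \<bullet> ?\<nu> r) * d l m
      - fst (q r \<star> (0, grad (H l m) r) \<star> g l m)" for l m r
    have bi: "boundary_integral \<Phi> \<gamma> (\<lambda>r v. \<psi> l m r v * d l m - fst (\<beta> l m r v \<star> g l m))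
        = surface_integral \<Phi> \<gamma> (s l m)" if "m \<in> {1..l}" "l \<in> {1..p}" for l m
    proof -
      have "is_exterior_derivative \<Phi> \<gamma> (\<lambda>r v. \<psi> l m r v * d l m - fst (\<beta> l m r v \<star> g l m))
          (\<lambda>r v w. chi_form \<Phi> \<gamma> r' l m r v w * d l m - fst (alpha_form \<Phi> \<gamma> r' l m r v w \<star> g l m))"
        using prim that
        by (intro is_exterior_derivative_combination[OF _ _ bounded_linear_mult_left bounded_linear_fst_qmult_right])
          auto
      from boundary_integral_eq_integral_exterior_derivative[OF patch this] show ?thesis
        unfolding surface_integral_def
        by (auto simp: s_def \<chi> \<alpha> algebra_simps bounded_bilinear.scaleR_left[OF bounded_bilinear_qmult]
            intro!: integral_cong)
    qed
    have int_s: "surface_integrable \<Phi> \<gamma> (s l m)" for l m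
      unfolding s_def
      by (rule surface_integrable_continuous[OF patch]) (intro continuous_intros cont_qmult cont cont_q)
    have "one_form_sum \<Phi> \<gamma> p \<psi> d \<beta> g = (\<Sum>l = 1..p. \<Sum>m = 1..l. surface_integral \<Phi> \<gamma> (s l m))"
      unfolding one_form_sum_def by (intro sum.cong refl bi)
    also have "\<dots> = surface_integral \<Phi> \<gamma> (\<lambda>r. \<Sum>l = 1..p. \<Sum>m = 1..l. s l m r)"
      by (simp add: surface_integral_sum surface_integrable_sum int_s)
    also have "\<dots> = surface_integral \<Phi> \<gamma> (\<lambda>r. ?G r * sigma_approx \<Phi> \<gamma> p d r + fst (q r \<star> ?\<delta>\<rho> r))"
    proof (rule surface_integral_cong)
      fix r
      have "fst (q r \<star> rho_approx p g r) = (\<Sum>l = 1..p. \<Sum>m = 1..l. fst (q r \<star> (0, grad (H l m) r) \<star> g l m))"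
        unfolding rho_approx_def
        by (simp add: bounded_bilinear.sum_right[OF bounded_bilinear_qmult] fst_sum qmult_assoc)
      \<comment> \<open>The first term on the right is exactly the double layer part of the summed
        \<open>chi_form\<close>, so only the single layer of the approximated density and the error
        of \<open>rho\<close> survive in the sum.\<close>
      moreover have "fst (q r \<star> ?\<delta>\<rho> r) = - rho p d r * (?dG r \<bullet> ?\<nu> r) - fst (q r \<star> rho_approx p g r)"
        by (simp only: bounded_bilinear.diff_right[OF bounded_bilinear_qmult] fst_diff q_def fst_qmult_pure_scalar)
      ultimately show "(\<Sum>l = 1..p. \<Sum>m = 1..l. s l m r) = ?G r * sigma_approx \<Phi> \<gamma> p d r + fst (q r \<star> ?\<delta>\<rho> r)"
        by (simp add: s_def sigma_approx_def rho_def sum_distrib_left sum_distrib_right sum_subtractf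
            sum.distrib inner_diff_left algebra_simps)
    qed
    also have "\<dots> = surface_integral \<Phi> \<gamma> (\<lambda>r. ?G r * sigma_approx \<Phi> \<gamma> p d r) + fst (quat_layer \<Phi> \<gamma> ?\<delta>\<rho> r')"
      unfolding quat surface_integral_bounded_linear[OF bounded_linear_fst int_q\<rho>, symmetric]
      by (rule surface_integral_add[OF int_G\<sigma>])
        (intro surface_integrable_continuous[OF patch] continuous_intros cont_qmult cont_q cont_\<rho>)
    finally have "one_form_sum \<Phi> \<gamma> p \<psi> d \<beta> g =
      surface_integral \<Phi> \<gamma> (\<lambda>r. ?G r * sigma_approx \<Phi> \<gamma> p d r) + fst (quat_layer \<Phi> \<gamma> ?\<delta>\<rho> r')" .
    moreover have "single_layer \<Phi> \<gamma> \<sigma> r' = surface_integral \<Phi> \<gamma> (\<lambda>r. ?G r * sigma_approx \<Phi> \<gamma> p d r)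
        + single_layer \<Phi> \<gamma> ?\<delta>\<sigma> r'"
      unfolding single_layer_def surface_integral_add[OF int_G\<sigma> int_G\<delta>\<sigma>, symmetric]
      by (rule surface_integral_cong) (simp add: algebra_simps)
    ultimately show ?thesis by simp
  qed

  have estimate: "\<bar>single_layer \<Phi> \<gamma> \<sigma> r' - one_form_sum \<Phi> \<gamma> p \<psi> d \<beta> g\<bar>
      \<le> \<epsilon>\<^sub>1 * surface_integral \<Phi> \<gamma> ?G + \<epsilon>\<^sub>2 * surface_integral \<Phi> \<gamma> (\<lambda>r. norm (?dG r))"
    if id: "single_layer \<Phi> \<gamma> \<sigma> r' = one_form_sum \<Phi> \<gamma> p \<psi> d \<beta> g
      + single_layer \<Phi> \<gamma> ?\<delta>\<sigma> r' - fst (quat_layer \<Phi> \<gamma> ?\<delta>\<rho> r')"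
    and bounds: "\<forall>r \<in> patch \<Phi> \<gamma>. \<bar>?\<delta>\<sigma> r\<bar> \<le> \<epsilon>\<^sub>1 \<and> norm (?\<delta>\<rho> r) \<le> \<epsilon>\<^sub>2" for \<psi> \<beta> \<epsilon>\<^sub>1 \<epsilon>\<^sub>2
  proof -
    have "norm (single_layer \<Phi> \<gamma> ?\<delta>\<sigma> r') \<le> surface_integral \<Phi> \<gamma> (\<lambda>r. \<epsilon>\<^sub>1 * ?G r)"
      unfolding single_layer_def
    proof (rule norm_surface_integral_le[OF int_G\<delta>\<sigma>])
      show "surface_integrable \<Phi> \<gamma> (\<lambda>r. \<epsilon>\<^sub>1 * ?G r)"
        by (rule surface_integrable_continuous[OF patch]) (intro continuous_intros cont)
      have "0 \<le> ?G r" for r by (simp add: green_def)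
      then show "norm (?G r * ?\<delta>\<sigma> r) \<le> \<epsilon>\<^sub>1 * ?G r" if "r \<in> patch \<Phi> \<gamma>" for r
        using bounds that by (simp add: abs_mult mult.commute[of \<epsilon>\<^sub>1] mult_left_mono)
    qed
    moreover have "norm (quat_layer \<Phi> \<gamma> ?\<delta>\<rho> r') \<le> surface_integral \<Phi> \<gamma> (\<lambda>r. \<epsilon>\<^sub>2 * norm (?dG r))"
      unfolding quat
    proof (rule norm_surface_integral_le[OF int_q\<rho>])
      show "surface_integrable \<Phi> \<gamma> (\<lambda>r. \<epsilon>\<^sub>2 * norm (?dG r))"
        by (rule surface_integrable_continuous[OF patch]) (intro continuous_intros cont)
      \<comment> \<open>A value of \<open>sgn\<close> is a unit vector or 0. Since the quaternion
        norm is multiplicative, this bounds \<open>q\<close> by the gradient of the kernel at every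
        point.\<close>
      have "norm (?\<nu> r) \<le> 1" for r by (simp add: normal_def Let_def norm_sgn)
      then have "norm (q r) \<le> norm (?dG r)" for r
        by (simp add: q_def norm_qmult norm_Pair mult_left_le)
      then show "norm (q r \<star> ?\<delta>\<rho> r) \<le> \<epsilon>\<^sub>2 * norm (?dG r)" if "r \<in> patch \<Phi> \<gamma>" for r
        \<comment> \<open>Monotonicity of the product uses that \<open>\<epsilon>\<^sub>2\<close> is
          nonnegative, which holds because it bounds a norm at \<open>r\<close>.\<close>
        unfolding norm_qmult using bounds that by (subst mult.commute) (intro mult_mono, auto intro: order_trans[OF norm_ge_zero])
    qed
    moreover have "\<bar>fst (quat_layer \<Phi> \<gamma> ?\<delta>\<rho> r')\<bar> \<le> norm (quat_layer \<Phi> \<gamma> ?\<delta>\<rho> r')"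
      using norm_fst_le[of "fst (quat_layer \<Phi> \<gamma> ?\<delta>\<rho> r')" "snd (quat_layer \<Phi> \<gamma> ?\<delta>\<rho> r')"]
      by simp
    moreover have "surface_integral \<Phi> \<gamma> (\<lambda>r. c * f r) = c * surface_integral \<Phi> \<gamma> f"
      if "continuous_on (region \<gamma>) (\<lambda>u. f (\<Phi> u))" for c and f :: "real ^ 3 \<Rightarrow> real"
      by (rule surface_integral_bounded_linear[OF bounded_linear_mult_right
          surface_integrable_continuous[OF patch that]])
    ultimately show ?thesis
      using id cont(1) continuous_on_norm[OF cont(2)] by simp
  qed
  show ?thesis
    using ex_\<psi> ex_\<beta> identity estimate by (intro conjI allI impI) blast+
qed

end
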